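(* Let $m\ge3$, $\alpha>0$, $\eta>1$, and consider the $m$ walks on the cycle $C_m$ (case $\epsilon=0$) with occupation process $X$ and transition map $\pi$ described in the context. Let $\mathrm{Fix}(\pi)=\{x\in\mathcal D:\pi(x)=x\}$ and $\mathfrak L(X)=\bigcap_{n\ge0}\overline{\bigcup_{k\ge n}\{X(k)\}}$. With $\mathcal C_1,\dots,\mathcal C_4$ as defined in the context: (i) $\bigcup_{r=1}^4\mathcal C_r=\mathrm{Fix}(\pi)$ and $\mathbb P\big(\mathfrak L(X)\subset\bigcup_{r=1}^4\mathcal C_r\big)=1$; (ii) if $m$ is not a multiple of four, then $\mathcal C_3\cup\mathcal C_4\subset\mathrm{Fix}(\pi)$ and $\mathbb P\big(\mathfrak L(X)\subset\mathcal C_3\cup\mathcal C_4\big)=1$.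
   Context: Vertices and walks are indexed by $[m]=\{1,\dots,m\}$ cyclically (index $m+1$ is $1$, index $0$ is $m$). Walk $i$ lives on $V^i=\{i,i+1\}$. $\mathcal D$ is the set of $x=(x_i^i,x_{i+1}^i)_{i\in[m]}$ with nonnegative entries and $x_i^i+x_{i+1}^i=1$ for each $i$. Set $$H_i^i(x)=(\eta-x_i^{i-1})^\alpha,\quad H_{i+1}^i(x)=(\eta-x_{i+1}^{i+1})^\alpha,\quad \pi_v^i(x)=\frac{x_v^iH_v^i(x)}{x_i^iH_i^i(x)+x_{i+1}^iH_{i+1}^i(x)}\ (v\in V^i),$$ and $\pi=(\pi_v^i):\mathcal D\to\mathcal D$. The walks $W^i(n)\in V^i$, $n\ge1$, satisfy: with $X_v^i(0)=1/2$, $X_v^i(n)=\frac1{2+n}\big(1+\sum_{k=1}^n\mathbf 1\{W^i(k)=v\}\big)$, $X(n)=(X_v^i(n))\in\mathcal D$ and $\mathcal F_n=\sigma(W^i(k):i\in[m],1\le k\le n)$ ($\mathcal F_0$ trivial), $\mathbb P(W^i(n+1)=v\mid\mathcal F_n)=\pi_v^i(X(n))$ for all $n\ge0$, and $W^1(n+1),\dots,W^m(n+1)$ are conditionally independent given $\mathcal F_n$. Notation: for $p\in\mathcal D$, the $i$-th "edge" of $p$ is the pair $\langle\langle a,1-a\rangle\rangle=(p_i^i,p_{i+1}^i)$; it is unmixed if $a\in\{0,1\}$ and mixed if $a\in(0,1)$. $p$ is written as the list of its edges $1,\dots,m$. The two unmixed edges $\langle\langle1,0\rangle\rangle$ and $\langle\langle0,1\rangle\rangle$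 have opposite directions. - $\mathcal C_1=\{(\langle\langle\frac12,\frac12\rangle\rangle,\dots,\langle\langle\frac12,\frac12\rangle\rangle)\}$. - $\mathcal C_2=\varnothing$ if $4\nmid m$; if $m=4k$, $\mathcal C_2$ is the set of $p=(p_{ab},\dots,p_{ab})$ ($k$ copies), $a,b\in(0,1)$, where $p_{ab}=(\langle\langle a,1-a\rangle\rangle,\langle\langle b,1-b\rangle\rangle,\langle\langle1-a,a\rangle\rangle,\langle\langle1-b,b\rangle\rangle)$. - $\mathcal C_3$: all $p\in\mathcal D$ all of whose edges are unmixed. - $\mathcal C_4$: all $p\in\mathcal D$ such that every mixed edge is flanked by (i.e. its two cyclic neighbours are) unmixed edges of opposite direction (one is $\langle\langle1,0\rangle\rangle$, the other $\langle\langle0,1\rangle\rangle$). *)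

theory Defs
  imports "HOL-Probability.Probability"
begin

section \<open>The cycle and the state space\<close>

definition cyc_succ :: "nat \<Rightarrow> nat \<Rightarrow> nat" where
  "cyc_succ m i = (if i = m then 1 else i + 1)"

definition cyc_pred :: "nat \<Rightarrow> nat \<Rightarrow> nat" where
  "cyc_pred m i = (if i = 1 then m else i - 1)"

definition V :: "nat \<Rightarrow> nat \<Rightarrow> nat set" where
  "V m i = {i, cyc_succ m i}"

text \<open>
  A point \<open>x\<close> of the state space is the function with \<open>x i v\<close> standing for \<open>x\<^sub>v\<^sup>i\<close>. All coordinates
  other than those with \<open>i \<in> {1..m}\<close> and \<open>v \<in> V m i\<close> are required to be 0, so that equality of
  points is equality of functions. On functions vanishing at these coordinates the product topology
  of \<open>nat \<Rightarrow> nat \<Rightarrow> real\<close> is the Euclidean topology of the remaining \<open>2 * m\<close> coordinates.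
\<close>

definition state_space :: "nat \<Rightarrow> (nat \<Rightarrow> nat \<Rightarrow> real) set" where
  "state_space m = {x.
     (\<forall>i\<in>{1..m}. (\<forall>v\<in>V m i. 0 \<le> x i v) \<and> x i i + x i (cyc_succ m i) = 1) \<and>
     (\<forall>i v. \<not> (i \<in> {1..m} \<and> v \<in> V m i) \<longrightarrow> x i v = 0)}"

text \<open>Only \<open>v \<in> V m i\<close> matters below: the second branch is the case \<open>v = cyc_succ m i\<close>.\<close>

definition H :: "nat \<Rightarrow> real \<Rightarrow> real \<Rightarrow> (nat \<Rightarrow> nat \<Rightarrow> real) \<Rightarrow> nat \<Rightarrow> nat \<Rightarrow> real" where
  "H m \<eta> \<alpha> x i v =
     (if v = i then (\<eta> - x (cyc_pred m i) i) powr \<alpha>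
      else (\<eta> - x (cyc_succ m i) (cyc_succ m i)) powr \<alpha>)"

definition trans_map ::
    "nat \<Rightarrow> real \<Rightarrow> real \<Rightarrow> (nat \<Rightarrow> nat \<Rightarrow> real) \<Rightarrow> nat \<Rightarrow> nat \<Rightarrow> real" where
  "trans_map m \<eta> \<alpha> x i v =
     (if i \<in> {1..m} \<and> v \<in> V m i
      then x i v * H m \<eta> \<alpha> x i v /
           (x i i * H m \<eta> \<alpha> x i i + x i (cyc_succ m i) * H m \<eta> \<alpha> x i (cyc_succ m i))
      else 0)"

definition Fix :: "nat \<Rightarrow> real \<Rightarrow> real \<Rightarrow> (nat \<Rightarrow> nat \<Rightarrow> real) set" where
  "Fix m \<eta> \<alpha> = {x \<in> state_space m. trans_map m \<eta> \<alpha> x = x}"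


section \<open>The walks and their occupation process\<close>

text \<open>
  \<open>W i n \<omega>\<close> is the position \<open>W\<^sup>i(n)\<close>; only \<open>i \<in> {1..m}\<close> and \<open>n \<ge> 1\<close> are used. For \<open>n = 0\<close> the
  occupation is \<open>1/2\<close> at both vertices of each \<open>V m i\<close>.
\<close>

definition occupation ::
    "nat \<Rightarrow> (nat \<Rightarrow> nat \<Rightarrow> 'a \<Rightarrow> nat) \<Rightarrow> nat \<Rightarrow> 'a \<Rightarrow> nat \<Rightarrow> nat \<Rightarrow> real" where
  "occupation m W n \<omega> i v =
     (if i \<in> {1..m} \<and> v \<in> V m i
      then 1 / (2 + real n) * (1 + (\<Sum>k=1..n. of_bool (W i k \<omega> = v)))
      else 0)"

definition history :: "'a measure \<Rightarrow> nat \<Rightarrow> (nat \<Rightarrow> nat \<Rightarrow> 'a \<Rightarrow> nat) \<Rightarrow> nat \<Rightarrow> 'a measure" where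
  "history M m W n =
     sigma (space M) {W i k -` A \<inter> space M | i k A. i \<in> {1..m} \<and> 1 \<le> k \<and> k \<le> n}"

definition event_cond_prob :: "'a measure \<Rightarrow> 'a measure \<Rightarrow> 'a set \<Rightarrow> 'a \<Rightarrow> real" where
  "event_cond_prob M F E = real_cond_exp M F (indicator E)"

text \<open>
  In the last clause the \<open>A i\<close> are arbitrary; taking some of them to be \<open>UNIV\<close> yields the product
  formula for every subfamily of the walks.
\<close>

definition interacting_walks ::
    "'a measure \<Rightarrow> nat \<Rightarrow> real \<Rightarrow> real \<Rightarrow> (nat \<Rightarrow> nat \<Rightarrow> 'a \<Rightarrow> nat) \<Rightarrow> bool" where
  "interacting_walks M m \<eta> \<alpha> W \<longleftrightarrow>
     (\<forall>i\<in>{1..m}. \<forall>n\<ge>1. W i n \<in> measurable M (count_space UNIV)) \<and>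
     (\<forall>i\<in>{1..m}. \<forall>n\<ge>1. \<forall>\<omega>\<in>space M. W i n \<omega> \<in> V m i) \<and>
     (\<forall>n. \<forall>i\<in>{1..m}. \<forall>v\<in>V m i. AE \<omega> in M.
        event_cond_prob M (history M m W n) {\<omega>'\<in>space M. W i (n+1) \<omega>' = v} \<omega>
          = trans_map m \<eta> \<alpha> (occupation m W n \<omega>) i v) \<and>
     (\<forall>n. \<forall>A :: nat \<Rightarrow> nat set. AE \<omega> in M.
        event_cond_prob M (history M m W n) {\<omega>'\<in>space M. \<forall>i\<in>{1..m}. W i (n+1) \<omega>' \<in> A i} \<omega>
          = (\<Prod>i\<in>{1..m}.
               event_cond_prob M (history M m W n) {\<omega>'\<in>space M. W i (n+1) \<omega>' \<in> A i} \<omega>))"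

definition limit_set :: "(nat \<Rightarrow> 'b::topological_space) \<Rightarrow> 'b set" where
  "limit_set x = (\<Inter>n. closure (\<Union>k\<in>{n..}. {x k}))"


section \<open>The four classes of points\<close>

definition edge :: "nat \<Rightarrow> (nat \<Rightarrow> nat \<Rightarrow> real) \<Rightarrow> nat \<Rightarrow> real \<times> real" where
  "edge m p i = (p i i, p i (cyc_succ m i))"

definition edges :: "nat \<Rightarrow> (nat \<Rightarrow> nat \<Rightarrow> real) \<Rightarrow> (real \<times> real) list" where
  "edges m p = map (edge m p) [1..<m+1]"

definition unmixed :: "real \<times> real \<Rightarrow> bool" where
  "unmixed e \<longleftrightarrow> (\<exists>a\<in>{0, 1}. e = (a, 1 - a))"

definition mixed :: "real \<times> real \<Rightarrow> bool" where
  "mixed e \<longleftrightarrow> (\<exists>a\<in>{0<..<1}. e = (a, 1 - a))"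

definition C1 :: "nat \<Rightarrow> (nat \<Rightarrow> nat \<Rightarrow> real) set" where
  "C1 m = {p \<in> state_space m. edges m p = replicate m (1/2, 1/2)}"

definition C2 :: "nat \<Rightarrow> (nat \<Rightarrow> nat \<Rightarrow> real) set" where
  "C2 m = {p \<in> state_space m. \<exists>k a b. m = 4 * k \<and> a \<in> {0<..<1} \<and> b \<in> {0<..<1} \<and>
     edges m p = concat (replicate k [(a, 1 - a), (b, 1 - b), (1 - a, a), (1 - b, b)])}"

definition C3 :: "nat \<Rightarrow> (nat \<Rightarrow> nat \<Rightarrow> real) set" where
  "C3 m = {p \<in> state_space m. \<forall>i\<in>{1..m}. unmixed (edge m p i)}"

text \<open>The equation of two-element sets says that one neighbour is \<open>(1, 0)\<close> and the other \<open>(0, 1)\<close>.\<close>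

definition C4 :: "nat \<Rightarrow> (nat \<Rightarrow> nat \<Rightarrow> real) set" where
  "C4 m = {p \<in> state_space m. \<forall>i\<in>{1..m}. mixed (edge m p i) \<longrightarrow>
     {edge m p (cyc_pred m i), edge m p (cyc_succ m i)} = {(1, 0), (0, 1)}}"

end

theory Submission
  imports Defs
begin

text \<open>
  Write \<open>a\<^sub>i\<close> for \<open>x\<^sub>i\<^sup>i\<close>; the other coordinate of walk \<open>i\<close> is \<open>1 - a\<^sub>i\<close>. The drift of \<open>a\<^sub>i\<close> vanishes iff
  \<open>a\<^sub>i (1 - a\<^sub>i) (a\<^sub>i\<^sub>-\<^sub>1 + a\<^sub>i\<^sub>+\<^sub>1 - 1)\<^sup>2 = 0\<close>, and it has the sign of \<open>a\<^sub>i\<^sub>-\<^sub>1 + a\<^sub>i\<^sub>+\<^sub>1 - 1\<close>, which is the derivative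
  with respect to \<open>a\<^sub>i\<close> of \<open>\<Sum> (a\<^sub>i - 1/2) (a\<^sub>i\<^sub>+\<^sub>1 - 1/2)\<close>. The expectation of this bounded function increases
  by a multiple of the sum of these squared expressions (\<open>defect\<close> below) over \<open>n\<close>, up to a summable error;
  since the steps are of order \<open>1/n\<close>, the defects tend to 0 almost surely.

  If 4 does not divide \<open>m\<close>, the only fixed point outside \<open>C3 m \<union> C4 m\<close> is the uniform one. Near it the
  transition map is monotone and expands sums of coordinates by a factor greater than 1, so for two
  monotonically coupled copies of the process with distinct ordered states the sum of the differences cannot stay
  bounded: the copies cannot both stay near the uniform point. As two such states are reached in one step
  with probability bounded below, the supremum \<open>q\<close> of the probabilities of staying there forever
  satisfies \<open>q \<le> (1 - \<rho>) q\<close> for some \<open>\<rho> > 0\<close>, hence vanishes.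
\<close>


section \<open>The cycle\<close>

text \<open>The defects vanish at the uniform point too, so their convergence to 0 cannot rule it
  out; this is what the coupling is for. That no other interior fixed point exists when 4 does not
  divide \<open>m\<close> comes from the reflections \<open>a (i + 2) = 1 - a i\<close>: an odd
  number of them closes up around the cycle and forces \<open>1/2\<close>. The quantitative form
  \<open>near_half\<close> also serves for paths: small defects with no coordinate close to 0 or 1
  mean being close to the uniform point. The coupling argument is run on functions of a time and a
  state rather than on paths. Probabilities of staying are defined by backward recursion with finite
  sums, so no coupled process and no chain from an arbitrary start has to be built on
  \<open>M\<close>; the walks enter only through the integrated Markov property
  \<open>one_step\<close>. Both target sets are written as zero sets, inside the compact
  \<open>state_space m\<close>, of one continuous nonnegative function. Compactness makes
  containment of the limit set equivalent to convergence of that function to 0 along the path, which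
  also makes the event measurable.\<close>

lemma cyc_succ_mem: "i \<in> {1..m} \<Longrightarrow> cyc_succ m i \<in> {1..m}"
  by (auto simp: cyc_succ_def)

lemma cyc_pred_mem: "i \<in> {1..m} \<Longrightarrow> cyc_pred m i \<in> {1..m}"
  by (auto simp: cyc_pred_def)

lemma cyc_succ_pred: "i \<in> {1..m} \<Longrightarrow> cyc_succ m (cyc_pred m i) = i"
  by (auto simp: cyc_succ_def cyc_pred_def)

lemma cyc_pred_succ: "i \<in> {1..m} \<Longrightarrow> cyc_pred m (cyc_succ m i) = i"
  by (auto simp: cyc_succ_def cyc_pred_def)

lemma cyc_succ_neq: "m \<ge> 3 \<Longrightarrow> cyc_succ m i \<noteq> i"
  by (auto simp: cyc_succ_def)

lemma sum_cyc_succ: "(\<Sum>i\<in>{1..m}. f (cyc_succ m i)) = (\<Sum>i\<in>{1..m}. f i)"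
  by (rule sum.reindex_bij_witness[of _ "cyc_pred m" "cyc_succ m"])
    (auto simp del: atLeastAtMost_iff One_nat_def simp: cyc_succ_mem cyc_pred_mem cyc_succ_pred cyc_pred_succ)

lemma sum_cyc_pred: "(\<Sum>i\<in>{1..m}. f (cyc_pred m i)) = (\<Sum>i\<in>{1..m}. f i)"
  by (rule sum.reindex_bij_witness[of _ "cyc_succ m" "cyc_pred m"])
    (auto simp del: atLeastAtMost_iff One_nat_def simp: cyc_succ_mem cyc_pred_mem cyc_succ_pred cyc_pred_succ)

text \<open>Climbing from \<open>i\<close> to \<open>m\<close>, wrapping to 1 and climbing again
  reaches every \<open>k\<close>. It serves to spread a local property around the whole
  cycle.\<close>

lemma cyc_induct:
  assumes "i \<in> {1..m}" "P i" "\<And>j. j \<in> {1..m} \<Longrightarrow> P j \<Longrightarrow> P (cyc_succ m j)" "k \<in> {1..m}"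
  shows "P k"
proof -
  have up: "P (j + n)" if "P j" "1 \<le> j" "j + n \<le> m" for j n
    using that
  proof (induction n)
    case (Suc n)
    then show ?case using assms(3)[of "j + n"] by (auto simp: cyc_succ_def)
  qed simp
  have "P m" using up[of i "m - i"] assms by simp
  hence "P 1" using assms(3)[of m] assms(1) by (auto simp: cyc_succ_def)
  thus ?thesis using up[of 1 "k - 1"] assms(4) by simp
qed

lemma unwind_antiperiodic:
  fixes D :: "nat \<Rightarrow> real"
  assumes "\<And>j. \<bar>D (j + 2) + D j\<bar> \<le> e"
  shows "\<bar>D (j + 2 * k) - (-1) ^ k * D j\<bar> \<le> real k * e"
proof (induction k)
  case (Suc k)
  have "\<bar>D (j + 2 * k + 2) + D (j + 2 * k)\<bar> \<le> e" by (rule assms)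
  moreover have "j + 2 * Suc k = j + 2 * k + 2" by simp
  ultimately show ?case using Suc by (simp add: algebra_simps abs_le_iff)
qed simp

text \<open>Each double step along the cycle reflects the deviation from 1/2 up to an error
  \<open>e\<close>. If 4 does not divide \<open>m\<close>, an odd number of double steps returns to
  \<open>i\<close>, so the deviation is nearly its own negative. The case \<open>e = 0\<close>
  solves the fixed point equations exactly.\<close>

lemma near_half:
  fixes a :: "nat \<Rightarrow> real"
  assumes m: "m \<ge> 3" "\<not> 4 dvd m" and i: "i \<in> {1..m}"
    and e: "\<And>i. i \<in> {1..m} \<Longrightarrow> \<bar>a (cyc_pred m i) + a (cyc_succ m i) - 1\<bar> \<le> e"
  shows "\<bar>a i - 1/2\<bar> \<le> real m * e"
proof -
  \<comment> \<open>An unbounded index running around the cycle, so that double steps need no case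
    distinction at the wrap-around.\<close>
  define v where "v = (\<lambda>j. j mod m + 1)"
  define D where "D = (\<lambda>j. a (v j) - 1/2)"
  have v: "v j \<in> {1..m}" for j using m(1) by (auto simp: v_def Suc_le_eq)
  have vs: "cyc_succ m (v j) = v (Suc j)" for j
    using m(1) by (auto simp: v_def cyc_succ_def mod_Suc)
  have vp: "cyc_pred m (v (Suc j)) = v j" for j
    using cyc_pred_succ[OF v[of j]] by (simp add: vs)
  have D: "\<bar>D (j + 2) + D j\<bar> \<le> e" for j
    using e[OF v[of "Suc j"]] by (simp add: vs vp D_def add_ac)
  have e0: "0 \<le> e" using D[of 0] by linarith
  \<comment> \<open>For odd \<open>m\<close> two full turns (\<open>k = m\<close>); otherwise one
    turn, where \<open>k = m / 2\<close> is odd because 4 does not divide \<open>m\<close>.\<close>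
  obtain k where k: "odd k" "k \<le> m" "m dvd 2 * k"
  proof (cases "odd m")
    case True then show ?thesis by (intro that[of m]) auto
  next
    case False
    then obtain k where mk: "m = 2 * k" by auto
    with m(2) have "odd k" by auto
    then show ?thesis by (intro that[of k]) (auto simp: mk)
  qed
  have "D (i - 1 + 2 * k) = D (i - 1)"
    using k(3) by (auto simp: D_def v_def elim!: dvdE)
  moreover have "v (i - 1) = i" using i by (auto simp: v_def)
  ultimately have "2 * a i - 1 \<le> real k * e \<and> 1 - 2 * a i \<le> real k * e"
    using unwind_antiperiodic[of D e "i - 1" k, OF D] k(1) by (simp add: D_def abs_le_iff)
  then have *: "2 * \<bar>a i - 1/2\<bar> \<le> real k * e" by (auto simp: abs_if)
  have "\<bar>a i - 1/2\<bar> \<le> 2 * \<bar>a i - 1/2\<bar>" by simp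
  also have "\<dots> \<le> real k * e" by (rule *)
  also have "\<dots> \<le> real m * e" using k(2) e0 by (intro mult_right_mono) auto
  finally show ?thesis .
qed


section \<open>The four classes\<close>

definition defect :: "nat \<Rightarrow> (nat \<Rightarrow> real) \<Rightarrow> nat \<Rightarrow> real" where
  "defect m a i = a i * (1 - a i) * (a (cyc_pred m i) + a (cyc_succ m i) - 1)^2"

definition diag :: "(nat \<Rightarrow> nat \<Rightarrow> real) \<Rightarrow> nat \<Rightarrow> real" where
  "diag x i = x i i"

lemma state_space_succ:
  assumes "x \<in> state_space m" "i \<in> {1..m}"
  shows "x i (cyc_succ m i) = 1 - diag x i"
  using assms by (force simp: state_space_def diag_def)

lemma state_space_pred:
  assumes "x \<in> state_space m" "i \<in> {1..m}"
  shows "x (cyc_pred m i) i = 1 - diag x (cyc_pred m i)"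
  using state_space_succ[OF assms(1) cyc_pred_mem[OF assms(2)]] assms(2) by (simp only: cyc_succ_pred)

lemma state_space_bounds:
  assumes "x \<in> state_space m" "i \<in> {1..m}"
  shows "0 \<le> diag x i" "diag x i \<le> 1"
proof -
  have "0 \<le> x i i" "0 \<le> x i (cyc_succ m i)"
    using assms by (auto simp: state_space_def V_def)
  with state_space_succ[OF assms] show "0 \<le> diag x i" "diag x i \<le> 1" by (auto simp: diag_def)
qed

lemma edge_state_space:
  "x \<in> state_space m \<Longrightarrow> i \<in> {1..m} \<Longrightarrow> edge m x i = (diag x i, 1 - diag x i)"
  by (simp only: edge_def state_space_succ) (simp add: diag_def)

lemma unmixed_edge:
  "x \<in> state_space m \<Longrightarrow> i \<in> {1..m} \<Longrightarrow> unmixed (edge m x i) \<longleftrightarrow> diag x i * (1 - diag x i) = 0"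
  by (auto simp: unmixed_def edge_state_space)

lemma mixed_edge:
  assumes "x \<in> state_space m" "i \<in> {1..m}"
  shows "mixed (edge m x i) \<longleftrightarrow> diag x i * (1 - diag x i) \<noteq> 0"
  using state_space_bounds[OF assms] by (auto simp: mixed_def edge_state_space[OF assms])

lemma opposite_edges_iff:
  fixes a b :: real
  shows "{(a, 1 - a), (b, 1 - b)} = {(1, 0), (0, 1)} \<longleftrightarrow> a * (1 - a) = 0 \<and> a + b = 1"
  by (auto simp: doubleton_eq_iff)

text \<open>Two adjacent mixed edges would propagate: a vanishing defect at the second one makes the
  next coordinate the reflection of the first, hence mixed again, and so on around the cycle up to
  \<open>j\<close>. Mixed edges are therefore isolated, and the neighbours of a mixed edge are
  unmixed with first coordinates adding up to 1.\<close>

lemma defect_zero_imp_C34: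
  assumes x: "x \<in> state_space m" and d: "\<And>i. i \<in> {1..m} \<Longrightarrow> defect m (diag x) i = 0"
    and j: "j \<in> {1..m}" "diag x j * (1 - diag x j) = 0"
  shows "x \<in> C4 m"
proof -
  let ?mx = "\<lambda>i. diag x i * (1 - diag x i) \<noteq> 0"
  have sum1: "diag x (cyc_pred m i) + diag x (cyc_succ m i) = 1" if "i \<in> {1..m}" "?mx i" for i
    using d[OF that(1)] that(2) by (auto simp: defect_def)
  have no2: "\<not> (?mx i \<and> ?mx (cyc_succ m i))" if i: "i \<in> {1..m}" for i
  proof
    assume "?mx i \<and> ?mx (cyc_succ m i)"
    then have "?mx j \<and> ?mx (cyc_succ m j)"
    proof (rule cyc_induct[OF i])
      fix l assume l: "l \<in> {1..m}" "?mx l \<and> ?mx (cyc_succ m l)"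
      have "diag x l + diag x (cyc_succ m (cyc_succ m l)) = 1"
        using sum1[OF cyc_succ_mem[OF l(1)]] l(2) unfolding cyc_pred_succ[OF l(1)] by blast
      hence "diag x (cyc_succ m (cyc_succ m l)) = 1 - diag x l" by simp
      with l show "?mx (cyc_succ m l) \<and> ?mx (cyc_succ m (cyc_succ m l))" by auto
    qed (rule j)
    with j show False by simp
  qed
  show ?thesis unfolding C4_def
  proof (intro CollectI conjI x ballI impI)
    fix i assume i: "i \<in> {1..m}" and "mixed (edge m x i)"
    then have mi: "?mx i" using mixed_edge[OF x] by simp
    have "diag x (cyc_pred m i) * (1 - diag x (cyc_pred m i)) = 0"
      using no2[OF cyc_pred_mem[OF i]] mi by (simp only: cyc_succ_pred[OF i]) blast
    then show "{edge m x (cyc_pred m i), edge m x (cyc_succ m i)} = {(1, 0), (0, 1)}"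
      using sum1[OF i mi] edge_state_space[OF x cyc_pred_mem[OF i]] edge_state_space[OF x cyc_succ_mem[OF i]]
      by (simp only: opposite_edges_iff)
  qed
qed

text \<open>Vacuous: without mixed edges the flanking condition asks nothing.\<close>

lemma C3_subset_C4: "C3 m \<subseteq> C4 m"
  unfolding C3_def C4_def using mixed_edge unmixed_edge by blast

lemma C4_defect:
  assumes "x \<in> C4 m" "i \<in> {1..m}"
  shows "defect m (diag x) i = 0"
proof -
  have x: "x \<in> state_space m" using assms by (simp add: C4_def)
  show ?thesis
  proof (cases "mixed (edge m x i)")
    case True
    then have "{edge m x (cyc_pred m i), edge m x (cyc_succ m i)} = {(1, 0), (0, 1)}"
      using assms unfolding C4_def by blast
    then have "diag x (cyc_pred m i) + diag x (cyc_succ m i) = 1"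
      using edge_state_space[OF x cyc_pred_mem[OF assms(2)]] edge_state_space[OF x cyc_succ_mem[OF assms(2)]]
      by (simp only: opposite_edges_iff)
    then show ?thesis by (simp add: defect_def)
  next
    case False
    then show ?thesis using mixed_edge[OF x assms(2)] by (simp add: defect_def)
  qed
qed

lemma C4_has_unmixed:
  assumes "x \<in> C4 m" "m \<ge> 3"
  shows "\<exists>i\<in>{1..m}. diag x i * (1 - diag x i) = 0"
proof (cases "mixed (edge m x 1)")
  case True
  have x: "x \<in> state_space m" using assms by (simp add: C4_def)
  have 1: "1 \<in> {1..m}" using assms(2) by simp
  have "{edge m x (cyc_pred m 1), edge m x (cyc_succ m 1)} = {(1, 0), (0, 1)}"
    using assms(1) 1 True unfolding C4_def by blast
  then have "diag x (cyc_pred m 1) * (1 - diag x (cyc_pred m 1)) = 0"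
    using edge_state_space[OF x cyc_pred_mem[OF 1]] edge_state_space[OF x cyc_succ_mem[OF 1]]
    by (simp only: opposite_edges_iff)
  then show ?thesis using cyc_pred_mem[OF 1] by blast
next
  case False
  then show ?thesis using mixed_edge[of x m 1] assms by (auto simp: C4_def)
qed

text \<open>The product vanishes iff some edge is unmixed. Both conditions are thus equations for
  continuous functions, the form needed for limit sets.\<close>

lemma C34_eq:
  assumes "m \<ge> 3"
  shows "C3 m \<union> C4 m = {x \<in> state_space m. (\<forall>i\<in>{1..m}. defect m (diag x) i = 0) \<and>
                          (\<Prod>i\<in>{1..m}. diag x i * (1 - diag x i)) = 0}"
proof (intro equalityI subsetI)
  fix x assume "x \<in> C3 m \<union> C4 m"
  then have x: "x \<in> C4 m" using C3_subset_C4 by auto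
  show "x \<in> {x \<in> state_space m. (\<forall>i\<in>{1..m}. defect m (diag x) i = 0) \<and>
                          (\<Prod>i\<in>{1..m}. diag x i * (1 - diag x i)) = 0}"
    using C4_has_unmixed[OF x assms] C4_defect[OF x] x by (simp add: C4_def)
next
  fix x assume x: "x \<in> {x \<in> state_space m. (\<forall>i\<in>{1..m}. defect m (diag x) i = 0) \<and>
                          (\<Prod>i\<in>{1..m}. diag x i * (1 - diag x i)) = 0}"
  then obtain j where "j \<in> {1..m}" "diag x j * (1 - diag x j) = 0"
    by (auto simp only: prod_zero_iff finite_atLeastAtMost)
  with x have "x \<in> C4 m" by (intro defect_zero_imp_C34) auto
  then show "x \<in> C3 m \<union> C4 m" by simp
qed

section \<open>The list descriptions of \<open>C1\<close> and \<open>C2\<close> in terms of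
  coordinates\<close>

lemma nth_concat_replicate:
  "j < k * length xs \<Longrightarrow> concat (replicate k xs) ! j = xs ! (j mod length xs)"
proof (induction k arbitrary: j)
  case (Suc k)
  show ?case
  proof (cases "j < length xs")
    case False
    then show ?thesis using Suc by (simp add: nth_append le_mod_geq)
  qed (simp add: nth_append)
qed simp

lemma nth_edges: "j < m \<Longrightarrow> edges m x ! j = edge m x (Suc j)"
  by (simp add: edges_def del: upt_Suc)

lemma length_edges [simp]: "length (edges m x) = m"
  by (simp add: edges_def)

lemma length_concat_replicate: "length (concat (replicate k xs)) = k * length xs"
  by (induction k) auto

lemma ball_Suc_iff: "(\<forall>j<m. P (Suc j)) \<longleftrightarrow> (\<forall>i\<in>{1..m}. P i)"
  unfolding atLeastAtMost_iff Ball_def using Suc_le_D by (auto simp: less_eq_Suc_le)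

lemma C1_iff:
  "x \<in> C1 m \<longleftrightarrow> x \<in> state_space m \<and> (\<forall>i\<in>{1..m}. diag x i = 1/2)"
proof (cases "x \<in> state_space m")
  case True
  have "edges m x = replicate m (1/2, 1/2) \<longleftrightarrow> (\<forall>j<m. edge m x (Suc j) = (1/2, 1/2))"
    by (simp add: list_eq_iff_nth_eq nth_edges)
  also have "\<dots> \<longleftrightarrow> (\<forall>i\<in>{1..m}. edge m x i = (1/2, 1/2))"
    by (rule ball_Suc_iff)
  also have "\<dots> \<longleftrightarrow> (\<forall>i\<in>{1..m}. diag x i = 1/2)"
    using edge_state_space[OF True] by auto
  finally show ?thesis using True by (simp add: C1_def)
qed (simp add: C1_def)

text \<open>The coordinates of a point of \<open>C2 m\<close>, indexed from 0.\<close>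

definition alternating :: "real \<Rightarrow> real \<Rightarrow> nat \<Rightarrow> real" where
  "alternating a b j = [a, b, 1 - a, 1 - b] ! (j mod 4)"

lemma less_4_cases: "(n::nat) < 4 \<Longrightarrow> n = 0 \<or> n = 1 \<or> n = 2 \<or> n = 3"
  by auto

lemma alternating_add_2: "alternating a b (j + 2) = 1 - alternating a b j"
proof -
  have "(j + 2) mod 4 = (j mod 4 + 2) mod 4" by (simp add: mod_simps)
  then show ?thesis
    using less_4_cases[of "j mod 4"] by (auto simp: alternating_def simp del: add_2_eq_Suc')
qed

lemma C2_iff:
  "x \<in> C2 m \<longleftrightarrow> x \<in> state_space m \<and> 4 dvd m \<and>
     (\<exists>a b. a \<in> {0<..<1} \<and> b \<in> {0<..<1} \<and> (\<forall>j<m. diag x (Suc j) = alternating a b j))"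
proof (cases "x \<in> state_space m")
  case True
  have "edges m x = concat (replicate k [(a, 1 - a), (b, 1 - b), (1 - a, a), (1 - b, b)])
      \<longleftrightarrow> (\<forall>j<m. diag x (Suc j) = alternating a b j)" if m: "m = 4 * k" for k a b
  proof -
    have e: "edge m x (Suc j) = (diag x (Suc j), 1 - diag x (Suc j))" if "j < m" for j
      using edge_state_space[OF True, of "Suc j"] that by simp
    have "concat (replicate k [(a, 1 - a), (b, 1 - b), (1 - a, a), (1 - b, b)]) ! j
        = (alternating a b j, 1 - alternating a b j)" if "j < m" for j
      using that m less_4_cases[of "j mod 4"]
      by (subst nth_concat_replicate) (auto simp: alternating_def)
    with e show ?thesis
      by (auto simp: list_eq_iff_nth_eq nth_edges length_concat_replicate m)
  qed
  then have "x \<in> C2 m \<longleftrightarrow> (\<exists>k a b. m = 4 * k \<and> a \<in> {0<..<1} \<and> b \<in> {0<..<1} \<and>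
      (\<forall>j<m. diag x (Suc j) = alternating a b j))"
    unfolding C2_def using True by blast
  then show ?thesis using True unfolding dvd_def by blast
qed (simp add: C2_def)

text \<open>The relation \<open>a (j + 2) = 1 - a j\<close> lets the first two coordinates determine
  all others, with period 4; if 4 does not divide \<open>m\<close>, \<open>near_half\<close> leaves
  only 1/2.\<close>

lemma all_mixed_imp_C12:
  assumes x: "x \<in> state_space m" and m: "m \<ge> 3"
    and d: "\<And>i. i \<in> {1..m} \<Longrightarrow> diag x (cyc_pred m i) + diag x (cyc_succ m i) = 1"
    and mx: "\<And>i. i \<in> {1..m} \<Longrightarrow> diag x i * (1 - diag x i) \<noteq> 0"
  shows "x \<in> C1 m \<union> C2 m"
proof (cases "4 dvd m")
  case False
  have "diag x i = 1/2" if "i \<in> {1..m}" for i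
    using near_half[OF m False that, of "diag x" 0] d by simp
  then show ?thesis using x by (simp add: C1_iff)
next
  case True
  let ?a = "diag x 1" and ?b = "diag x 2"
  have ab: "?a \<in> {0<..<1}" "?b \<in> {0<..<1}"
    using mx[of 1] mx[of 2] state_space_bounds[OF x, of 1] state_space_bounds[OF x, of 2] m
    by (auto simp: less_le)
  have "diag x (Suc j) = alternating ?a ?b j" if "j < m" for j
    using that
  proof (induction j rule: less_induct)
    case (less j)
    consider "j = 0" | "j = 1" | l where "j = l + 2"
      by (metis One_nat_def add_2_eq_Suc' not0_implies_Suc)
    then show ?case
    proof cases
      case 3
      then have "diag x (Suc l) + diag x (Suc j) = 1"
        using d[of "Suc (Suc l)"] less.prems by (simp add: cyc_pred_def cyc_succ_def)
      then show ?thesis using 3 less.IH[of l] less.prems by (simp add: alternating_add_2 del: add_2_eq_Suc')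
    qed (auto simp: alternating_def numeral_2_eq_2)
  qed
  then have "x \<in> C2 m" unfolding C2_iff using True x ab by blast
  then show ?thesis by simp
qed

lemma C1234_eq:
  assumes "m \<ge> 3"
  shows "C1 m \<union> C2 m \<union> C3 m \<union> C4 m = {x \<in> state_space m. \<forall>i\<in>{1..m}. defect m (diag x) i = 0}"
proof (intro equalityI subsetI)
  fix x assume x: "x \<in> {x \<in> state_space m. \<forall>i\<in>{1..m}. defect m (diag x) i = 0}"
  show "x \<in> C1 m \<union> C2 m \<union> C3 m \<union> C4 m"
  proof (cases "\<exists>j\<in>{1..m}. diag x j * (1 - diag x j) = 0")
    case True
    then show ?thesis using x defect_zero_imp_C34[of x m] by blast
  next
    case False
    then have "diag x (cyc_pred m i) + diag x (cyc_succ m i) = 1" if "i \<in> {1..m}" for i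
      using x that by (auto simp: defect_def)
    then show ?thesis using x False all_mixed_imp_C12[of x m] assms by blast
  qed
next
  fix x assume "x \<in> C1 m \<union> C2 m \<union> C3 m \<union> C4 m"
  then consider "x \<in> C1 m" | "x \<in> C2 m" | "x \<in> C4 m" using C3_subset_C4 by auto
  then show "x \<in> {x \<in> state_space m. \<forall>i\<in>{1..m}. defect m (diag x) i = 0}"
  proof cases
    case 1
    then have x: "x \<in> state_space m" "\<And>i. i \<in> {1..m} \<Longrightarrow> diag x i = 1/2" by (auto simp: C1_iff)
    have "diag x (cyc_pred m i) + diag x (cyc_succ m i) = 1" if "i \<in> {1..m}" for i
      using x(2)[OF cyc_pred_mem[OF that]] x(2)[OF cyc_succ_mem[OF that]] by simp
    then show ?thesis using x(1) by (simp add: defect_def)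
  next
    case 2
    then obtain a b where x: "x \<in> state_space m" "4 dvd m" "\<forall>j<m. diag x (Suc j) = alternating a b j"
      unfolding C2_iff by (elim conjE exE)
    have "diag x (cyc_pred m i) + diag x (cyc_succ m i) = 1" if i: "i \<in> {1..m}" for i
    proof -
      obtain l where l: "i = Suc l" "l < m" using i by (cases i) auto
      have s: "diag x (cyc_succ m i) = alternating a b (Suc l)"
      proof (cases "i = m")
        case True
        then have "alternating a b (Suc l) = alternating a b 0"
          using x(2) l by (simp add: alternating_def)
        with True show ?thesis using x(3) l by (auto simp: cyc_succ_def)
      next
        case False
        then show ?thesis using x(3) l by (auto simp: cyc_succ_def)
      qed
      have p: "diag x (cyc_pred m i) = 1 - alternating a b (Suc l)"
      proof (cases l)
        case 0
        \<comment> \<open>Wrap-around at vertex 1: its predecessor has index \<open>m - 1\<close>,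
          and two further places lead to \<open>m + 1\<close>, which is 1 modulo 4.\<close>
        then have "diag x (cyc_pred m i) = alternating a b (m - 1)"
          using x(3)[rule_format, of "m - 1"] l by (simp add: cyc_pred_def)
        also have "1 - \<dots> = alternating a b (m - 1 + 2)" by (simp only: alternating_add_2)
        then have "alternating a b (m - 1) = 1 - alternating a b (m - 1 + 2)" by simp
        also have "alternating a b (m - 1 + 2) = alternating a b (1 + m)"
          using l by simp
        also have "\<dots> = alternating a b 1" using x(2) by (auto simp: alternating_def elim!: dvdE)
        finally show ?thesis using 0 by simp
      next
        case (Suc n)
        then show ?thesis using x(3) l alternating_add_2[of a b n] by (simp add: cyc_pred_def)
      qed
      show ?thesis using s p by simp
    qed
    then show ?thesis using x by (auto simp: defect_def)
  next
    case 3
    then show ?thesis using C4_defect by (auto simp: C4_def)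
  qed
qed


section \<open>One step of the dynamics\<close>

definition share :: "real \<Rightarrow> real \<Rightarrow> real \<Rightarrow> real" where
  "share p q t = t * p / (t * p + (1 - t) * q)"

lemma mix_bounds:
  fixes p q t lo hi :: real
  assumes "lo \<le> p" "lo \<le> q" "p \<le> hi" "q \<le> hi" "0 \<le> t" "t \<le> 1"
  shows "lo \<le> t * p + (1 - t) * q" "t * p + (1 - t) * q \<le> hi"
proof -
  have "t * lo + (1 - t) * lo \<le> t * p + (1 - t) * q"
    using assms by (intro add_mono mult_left_mono) auto
  then show "lo \<le> t * p + (1 - t) * q" by (simp add: algebra_simps)
  have "t * p + (1 - t) * q \<le> t * hi + (1 - t) * hi"
    using assms by (intro add_mono mult_left_mono) auto
  then show "t * p + (1 - t) * q \<le> hi" by (simp add: algebra_simps)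
qed

lemma mix_pos:
  fixes p q t :: real
  assumes "0 < p" "0 < q" "0 \<le> t" "t \<le> 1"
  shows "0 < t * p + (1 - t) * q"
proof -
  have "0 < min p q" using assms by simp
  also have "\<dots> \<le> t * p + (1 - t) * q"
    using assms by (intro mix_bounds(1)[of _ _ _ "max p q"]) auto
  finally show ?thesis .
qed

lemma share_bounds:
  assumes "0 < p" "0 < q" "0 \<le> t" "t \<le> 1"
  shows "0 \<le> share p q t" "share p q t \<le> 1"
  using mix_pos[OF assms] assms by (auto simp: share_def divide_simps)

lemma share_compl:
  assumes "0 < p" "0 < q" "0 \<le> t" "t \<le> 1"
  shows "1 - share p q t = share q p (1 - t)"
  using mix_pos[OF assms] by (simp add: share_def field_simps)

lemma share_ge:
  assumes "0 < lo" "lo \<le> p" "lo \<le> q" "p \<le> hi" "q \<le> hi" "1/4 \<le> t" "t \<le> 1"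
  shows "lo / (4 * hi) \<le> share p q t"
proof -
  have "lo / (4 * hi) = (1/4 * lo) / hi" by simp
  also have "\<dots> \<le> (t * p) / (t * p + (1 - t) * q)"
    using assms mix_bounds[of lo p q hi t] mix_pos[of p q t]
    by (intro frac_le mult_mono) auto
  finally show ?thesis by (simp add: share_def)
qed

lemma share_minus:
  assumes "0 < p" "0 < q" "0 \<le> t" "t \<le> 1"
  shows "share p q t - t = t * (1 - t) * (p - q) / (t * p + (1 - t) * q)"
  using mix_pos[OF assms] by (simp add: share_def field_simps)

text \<open>Exact differences, here and in \<open>share_diff_weight\<close>, take the place of
  partial derivatives; bounds on the weights control the denominators.\<close>

lemma share_diff_arg:
  assumes "0 < p" "0 < q" "0 \<le> t" "t \<le> 1" "0 \<le> t'" "t' \<le> 1"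
  shows "share p q t' - share p q t =
    (t' - t) * ((p * q) / ((t' * p + (1 - t') * q) * (t * p + (1 - t) * q)))"
  using mix_pos[OF assms(1,2,3,4)] mix_pos[OF assms(1,2,5,6)]
  by (simp add: share_def divide_simps) (simp add: algebra_simps)

lemma share_diff_weight:
  assumes "0 < p" "0 < q" "0 < p'" "0 \<le> t" "t \<le> 1"
  shows "share p' q t - share p q t =
    (p' - p) * ((t * (1 - t) * q) / ((t * p' + (1 - t) * q) * (t * p + (1 - t) * q)))"
  using mix_pos[of p q t] mix_pos[of p' q t] assms
  by (simp add: share_def divide_simps) (simp add: algebra_simps)

lemma share_weight_growth:
  assumes "0 < lo" "lo \<le> p" "p \<le> p'" "p' \<le> hi" "lo \<le> q" "q \<le> hi" "1/4 \<le> t" "t \<le> 3/4"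
  shows "(p' - p) * (3/16 * lo / hi^2) \<le> share p' q t - share p q t"
proof -
  \<comment> \<open>Expanding this product yields 3/16, the minimum of \<open>t * (1 - t)\<close> on
    [1/4, 3/4].\<close>
  have "0 \<le> (t - 1/4) * (3/4 - t)" using assms by simp
  then have t: "3/16 \<le> t * (1 - t)" by (simp add: field_simps)
  have "3/16 * lo / hi^2 \<le> (t * (1 - t) * q) / ((t * p' + (1 - t) * q) * (t * p + (1 - t) * q))"
    unfolding power2_eq_square
    using assms t mix_bounds[of lo p q hi t] mix_pos[of p q t]
      mix_bounds[of lo p' q hi t] mix_pos[of p' q t]
    by (intro frac_le mult_mono) auto
  then have "(p' - p) * (3/16 * lo / hi^2) \<le>
      (p' - p) * ((t * (1 - t) * q) / ((t * p' + (1 - t) * q) * (t * p + (1 - t) * q)))"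
    using assms by (intro mult_left_mono) auto
  also have "\<dots> = share p' q t - share p q t"
    using assms by (intro share_diff_weight[symmetric]) auto
  finally show ?thesis .
qed

text \<open>The factor \<open>(lo / hi)^2\<close> is close to 1 when the weights are nearly equal;
  for equal weights the choice probability is the occupation itself.\<close>

lemma share_arg_growth:
  assumes "0 < lo" "lo \<le> p" "p \<le> hi" "lo \<le> q" "q \<le> hi" "0 \<le> t" "t \<le> t'" "t' \<le> 1"
  shows "(t' - t) * (lo / hi)^2 \<le> share p q t' - share p q t"
proof -
  have "(lo / hi)^2 = (lo * lo) / (hi * hi)" by (simp add: power2_eq_square)
  also have "\<dots> \<le> (p * q) / ((t' * p + (1 - t') * q) * (t * p + (1 - t) * q))"
    using assms mix_bounds[of lo p q hi t] mix_pos[of p q t]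
      mix_bounds[of lo p q hi t'] mix_pos[of p q t']
    by (intro frac_le mult_mono) auto
  finally have "(t' - t) * (lo / hi)^2 \<le>
      (t' - t) * ((p * q) / ((t' * p + (1 - t') * q) * (t * p + (1 - t) * q)))"
    using assms by (intro mult_left_mono) auto
  also have "\<dots> = share p q t' - share p q t"
    using assms by (intro share_diff_arg[symmetric]) auto
  finally show ?thesis .
qed

text \<open>Mean value theorem. The derivative is increasing or decreasing according to whether
  \<open>\<alpha> \<ge> 1\<close>, so one end of the interval minimises it.\<close>

lemma powr_growth:
  fixes \<alpha> l u :: real
  assumes "0 < \<alpha>" "0 < l"
  shows "\<exists>\<kappa>>0. \<forall>x y. l \<le> x \<and> x \<le> y \<and> y \<le> u \<longrightarrow> \<kappa> * (y - x) \<le> y powr \<alpha> - x powr \<alpha>"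
proof (intro exI conjI allI impI)
  \<comment> \<open>\<open>max l u\<close> keeps the constant positive even if \<open>u\<close> lies
    below \<open>l\<close>.\<close>
  let ?\<kappa> = "\<alpha> * min (l powr (\<alpha> - 1)) (max l u powr (\<alpha> - 1))"
  show "0 < ?\<kappa>" using assms by (auto simp: min_def max_def)
  fix x y assume xy: "l \<le> x \<and> x \<le> y \<and> y \<le> u"
  show "?\<kappa> * (y - x) \<le> y powr \<alpha> - x powr \<alpha>"
  proof (cases "x = y")
    case False
    then have "x < y" using xy by simp
    moreover have "((\<lambda>t. t powr \<alpha>) has_real_derivative \<alpha> * t powr (\<alpha> - 1)) (at t)" if "x \<le> t" for t
      using has_real_derivative_powr[of t \<alpha>] that xy assms by auto
    ultimately obtain z where z: "x < z" "z < y" "y powr \<alpha> - x powr \<alpha> = (y - x) * (\<alpha> * z powr (\<alpha> - 1))"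
      using MVT2[of x y "\<lambda>t. t powr \<alpha>" "\<lambda>t. \<alpha> * t powr (\<alpha> - 1)"] by blast
    have "min (l powr (\<alpha> - 1)) (max l u powr (\<alpha> - 1)) \<le> z powr (\<alpha> - 1)"
    proof (cases "\<alpha> \<ge> 1")
      case True
      then show ?thesis using z xy assms by (intro min.coboundedI1 powr_mono2) auto
    next
      case False
      then show ?thesis using z xy assms by (intro min.coboundedI2 powr_mono2') auto
    qed
    then show ?thesis using z(3) assms(1) \<open>x < y\<close> by (simp add: mult.commute)
  qed simp
qed

section \<open>The transition map in the coordinates \<open>a i\<close>\<close>

locale cycle_dynamics =
  fixes m :: nat and \<eta> \<alpha> :: real
  assumes m: "m \<ge> 3" and \<alpha>: "\<alpha> > 0" and \<eta>: "\<eta> > 1"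
begin

definition cube :: "(nat \<Rightarrow> real) set" where
  "cube = {a. \<forall>i\<in>{1..m}. 0 \<le> a i \<and> a i \<le> 1}"

text \<open>The preceding walk occupies vertex \<open>i\<close> with proportion
  \<open>1 - a (cyc_pred m i)\<close>, so this is \<open>H\<close> at \<open>i\<close>; likewise
  \<open>wsucc\<close> is \<open>H\<close> at the successor.\<close>

definition wpred :: "(nat \<Rightarrow> real) \<Rightarrow> nat \<Rightarrow> real" where
  "wpred a i = (\<eta> - 1 + a (cyc_pred m i)) powr \<alpha>"

definition wsucc :: "(nat \<Rightarrow> real) \<Rightarrow> nat \<Rightarrow> real" where
  "wsucc a i = (\<eta> - a (cyc_succ m i)) powr \<alpha>"

definition tp :: "(nat \<Rightarrow> real) \<Rightarrow> nat \<Rightarrow> real" where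
  "tp a i = share (wpred a i) (wsucc a i) (a i)"

lemma cubeD: "a \<in> cube \<Longrightarrow> i \<in> {1..m} \<Longrightarrow> 0 \<le> a i \<and> a i \<le> 1"
  by (auto simp: cube_def)

lemma weights_pos:
  assumes "a \<in> cube" "i \<in> {1..m}"
  shows "0 < wpred a i" "0 < wsucc a i"
  using cubeD[OF assms(1) cyc_pred_mem[OF assms(2)]] cubeD[OF assms(1) cyc_succ_mem[OF assms(2)]] \<eta>
  by (auto simp: wpred_def wsucc_def)

lemma weights_bounds:
  assumes "a \<in> cube" "i \<in> {1..m}"
  shows "(\<eta> - 1) powr \<alpha> \<le> wpred a i" "(\<eta> - 1) powr \<alpha> \<le> wsucc a i"
    "wpred a i \<le> \<eta> powr \<alpha>" "wsucc a i \<le> \<eta> powr \<alpha>"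
  using cubeD[OF assms(1) cyc_pred_mem[OF assms(2)]] cubeD[OF assms(1) cyc_succ_mem[OF assms(2)]] \<eta> \<alpha>
  by (auto simp: wpred_def wsucc_def intro!: powr_mono2)

lemma tp_bounds:
  assumes "a \<in> cube" "i \<in> {1..m}"
  shows "0 \<le> tp a i" "tp a i \<le> 1"
  using share_bounds[OF weights_pos[OF assms]] cubeD[OF assms] by (auto simp: tp_def)

text \<open>By \<open>share_minus\<close> the drift is \<open>a i * (1 - a i)\<close> times the
  difference of the two weights, divided by their weighted mean. The weights are powers of bases in
  the interval from \<open>\<eta> - 1\<close> to \<open>\<eta>\<close> whose difference is the
  neighbour expression, so \<open>powr_growth\<close> applies; the mean is at most
  \<open>\<eta> powr \<alpha>\<close>.\<close>

lemma drift_lower_bound: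
  "\<exists>c>0. \<forall>a\<in>cube. \<forall>i\<in>{1..m}.
     c * defect m a i \<le> (tp a i - a i) * (a (cyc_pred m i) + a (cyc_succ m i) - 1)"
proof -
  obtain \<kappa> where \<kappa>: "\<kappa> > 0" "\<And>x y. \<lbrakk>\<eta> - 1 \<le> x; x \<le> y; y \<le> \<eta>\<rbrakk> \<Longrightarrow> \<kappa> * (y - x) \<le> y powr \<alpha> - x powr \<alpha>"
    using powr_growth[OF \<alpha>, of "\<eta> - 1" \<eta>] \<eta> by auto
  show ?thesis
  proof (intro exI[of _ "\<kappa> / \<eta> powr \<alpha>"] conjI ballI)
    show "0 < \<kappa> / \<eta> powr \<alpha>" using \<kappa> \<eta> by simp
    fix a i assume a: "a \<in> cube" and i: "i \<in> {1..m}"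
    let ?p = "wpred a i" and ?q = "wsucc a i" and ?t = "a i"
    define d where "d = a (cyc_pred m i) + a (cyc_succ m i) - 1"
    have t: "0 \<le> ?t" "?t \<le> 1" using cubeD[OF a i] by auto
    have nb: "0 \<le> a (cyc_pred m i)" "a (cyc_pred m i) \<le> 1" "0 \<le> a (cyc_succ m i)" "a (cyc_succ m i) \<le> 1"
      using cubeD[OF a cyc_pred_mem[OF i]] cubeD[OF a cyc_succ_mem[OF i]] by auto
    have pq: "\<kappa> * d^2 \<le> (?p - ?q) * d"
    proof (cases "d \<ge> 0")
      case True
      then have "\<kappa> * d \<le> ?p - ?q"
        using \<kappa>(2)[of "\<eta> - a (cyc_succ m i)" "\<eta> - 1 + a (cyc_pred m i)"] nb
        by (simp add: d_def wpred_def wsucc_def algebra_simps)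
      from mult_right_mono[OF this True] show ?thesis by (simp add: power2_eq_square mult.assoc)
    next
      case False
      then have "\<kappa> * (- d) \<le> ?q - ?p"
        using \<kappa>(2)[of "\<eta> - 1 + a (cyc_pred m i)" "\<eta> - a (cyc_succ m i)"] nb
        by (simp add: d_def wpred_def wsucc_def algebra_simps)
      from mult_right_mono[OF this, of "- d"] False show ?thesis
        by (simp add: power2_eq_square algebra_simps)
    qed
    have "0 \<le> \<kappa> * d^2" using \<kappa>(1) by simp
    also note pq
    finally have nn: "0 \<le> ?t * (1 - ?t) * ((?p - ?q) * d)"
      using t by (intro mult_nonneg_nonneg[of "?t * (1 - ?t)"]) auto
    have le: "?t * (1 - ?t) * (\<kappa> * d^2) \<le> ?t * (1 - ?t) * ((?p - ?q) * d)"
      using t by (intro mult_left_mono pq) auto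
    have "\<kappa> / \<eta> powr \<alpha> * defect m a i = (?t * (1 - ?t) * (\<kappa> * d^2)) / \<eta> powr \<alpha>"
      by (simp add: defect_def d_def)
    also have "\<dots> \<le> (?t * (1 - ?t) * ((?p - ?q) * d)) / (?t * ?p + (1 - ?t) * ?q)"
      by (rule frac_le[OF nn le mix_pos[OF weights_pos[OF a i] t]
            mix_bounds(2)[OF weights_bounds[OF a i] t]])
    also have "\<dots> = (tp a i - a i) * d"
      using share_minus[OF weights_pos[OF a i] t] by (simp add: tp_def)
    finally show "\<kappa> / \<eta> powr \<alpha> * defect m a i \<le> (tp a i - a i) * (a (cyc_pred m i) + a (cyc_succ m i) - 1)"
      by (simp add: d_def)
  qed
qed

lemma tp_fixed_iff:
  assumes a: "a \<in> cube" and i: "i \<in> {1..m}"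
  shows "tp a i = a i \<longleftrightarrow> defect m a i = 0"
proof
  assume "tp a i = a i"
  with drift_lower_bound a i obtain c where "c > 0" "c * defect m a i \<le> 0" by force
  moreover have "0 \<le> defect m a i" using cubeD[OF a i] by (simp add: defect_def)
  ultimately show "defect m a i = 0" by (simp add: mult_le_0_iff)
next
  assume "defect m a i = 0"
  then have "a i * (1 - a i) = 0 \<or> \<eta> - 1 + a (cyc_pred m i) = \<eta> - a (cyc_succ m i)"
    by (auto simp: defect_def)
  then have "a i * (1 - a i) = 0 \<or> wpred a i = wsucc a i"
    unfolding wpred_def wsucc_def by (elim disjE) (rule disjI1, assumption, rule disjI2, simp only:)
  then have "a i * (1 - a i) * (wpred a i - wsucc a i) = 0" by auto
  then have "tp a i - a i = 0"
    unfolding tp_def by (subst share_minus) (use weights_pos[OF a i] cubeD[OF a i] in auto)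
  then show "tp a i = a i" by simp
qed

section \<open>Behaviour near the uniform point\<close>

definition near :: "real \<Rightarrow> (nat \<Rightarrow> real) \<Rightarrow> bool" where
  "near r a \<longleftrightarrow> (\<forall>i\<in>{1..m}. \<bar>a i - 1/2\<bar> \<le> r)"

lemma near_cube: "near r a \<Longrightarrow> r \<le> 1/4 \<Longrightarrow> a \<in> cube"
  by (force simp: near_def cube_def abs_le_iff)

lemma nearD: "near r a \<Longrightarrow> i \<in> {1..m} \<Longrightarrow> 1/2 - r \<le> a i \<and> a i \<le> 1/2 + r"
  by (force simp: near_def abs_le_iff)

text \<open>Gives every joint pattern of choices a minimal mass that depends neither on the time nor
  on the state near the uniform point.\<close>

lemma tp_near_bounds:
  assumes "near r a" "r \<le> 1/4" "i \<in> {1..m}"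
  shows "(\<eta> - 1) powr \<alpha> / (4 * \<eta> powr \<alpha>) \<le> tp a i" "(\<eta> - 1) powr \<alpha> / (4 * \<eta> powr \<alpha>) \<le> 1 - tp a i"
proof -
  note c = near_cube[OF assms(1,2)]
  have t: "1/4 \<le> a i" "a i \<le> 3/4" using nearD[OF assms(1,3)] assms(2) by auto
  have p: "0 < (\<eta> - 1) powr \<alpha>" using \<eta> by simp
  show "(\<eta> - 1) powr \<alpha> / (4 * \<eta> powr \<alpha>) \<le> tp a i"
    unfolding tp_def using t by (intro share_ge p weights_bounds c assms(3)) auto
  have "1 - tp a i = share (wsucc a i) (wpred a i) (1 - a i)"
    unfolding tp_def using t by (intro share_compl weights_pos c assms(3)) auto
  also have "(\<eta> - 1) powr \<alpha> / (4 * \<eta> powr \<alpha>) \<le> \<dots>"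
    using t by (intro share_ge p weights_bounds c assms(3)) auto
  finally show "(\<eta> - 1) powr \<alpha> / (4 * \<eta> powr \<alpha>) \<le> 1 - tp a i" .
qed

text \<open>
  At the uniform point the derivative of \<open>tp\<close> with respect to the own coordinate is 1 and those with
  respect to the two neighbours are positive: in the order of \<open>nat \<Rightarrow> real\<close> the map \<open>tp\<close> is
  monotone and expands sums of coordinates.
\<close>

definition expanding :: "real \<Rightarrow> real \<Rightarrow> bool" where
  "expanding r c \<longleftrightarrow> 0 < r \<and> r \<le> 1/4 \<and> 0 < c \<and> c \<le> 1 \<and>
     (\<forall>a a'. near r a \<and> near r a' \<and> (\<forall>i\<in>{1..m}. a i \<le> a' i) \<longrightarrow>
        (\<forall>i\<in>{1..m}. tp a i \<le> tp a' i) \<and>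
        (1 + c) * (\<Sum>i\<in>{1..m}. a' i - a i) \<le> (\<Sum>i\<in>{1..m}. tp a' i - tp a i))"

text \<open>Passing from \<open>a\<close> to \<open>a'\<close> in three moves (predecessor weight,
  successor weight, own occupation) gains at least \<open>K\<close>, \<open>K\<close> and
  \<open>1 - K\<close> times the respective coordinate differences. Summed around the cycle, each
  difference is counted with total factor \<open>1 + K\<close>.\<close>

lemma ex_expanding: "\<exists>r c. expanding r c"
proof -
  define lo hi where "lo = (\<eta> - 1) powr \<alpha>" and "hi = \<eta> powr \<alpha>"
  have lo: "0 < lo" using \<eta> by (simp add: lo_def)
  have lohi: "lo \<le> hi" using \<eta> \<alpha> by (auto simp: lo_def hi_def intro!: powr_mono2)
  obtain \<kappa> where \<kappa>: "\<kappa> > 0" "\<And>x y. \<lbrakk>\<eta> - 1 \<le> x; x \<le> y; y \<le> \<eta>\<rbrakk> \<Longrightarrow> \<kappa> * (y - x) \<le> y powr \<alpha> - x powr \<alpha>"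
    using powr_growth[OF \<alpha>, of "\<eta> - 1" \<eta>] \<eta> by auto
  \<comment> \<open>The growth of a weight in the neighbour's coordinate times the growth of
    \<open>share\<close> in a weight; the cap at 1 keeps \<open>1 - K\<close> nonnegative.\<close>
  define K where "K = min 1 (\<kappa> * (3/16 * lo / hi^2))"
  have K: "0 < K" "K \<le> 1" "K \<le> \<kappa> * (3/16 * lo / hi^2)" using \<kappa>(1) lo lohi by (auto simp: K_def)
  \<comment> \<open>As \<open>r\<close> tends to 0 all weights approach
    \<open>(\<eta> - 1/2) powr \<alpha>\<close>, so the growth factor in the own coordinate tends to
    1 and exceeds \<open>1 - K\<close> for some small \<open>r\<close>.\<close>
  have "((\<lambda>r. ((\<eta> - 1/2 - r) powr \<alpha> / (\<eta> - 1/2 + r) powr \<alpha>)^2) \<longlongrightarrow>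
      ((\<eta> - 1/2 - 0) powr \<alpha> / (\<eta> - 1/2 + 0) powr \<alpha>)^2) (at_right 0)"
    using \<eta> by (intro tendsto_intros) auto
  moreover have "((\<eta> - 1/2 - 0) powr \<alpha> / (\<eta> - 1/2 + 0) powr \<alpha>)^2 > 1 - K"
    using \<eta> K by simp
  ultimately have "eventually (\<lambda>r. ((\<eta> - 1/2 - r) powr \<alpha> / (\<eta> - 1/2 + r) powr \<alpha>)^2 > 1 - K) (at_right 0)"
    by (rule order_tendstoD(1))
  moreover have "eventually (\<lambda>r::real. 0 < r \<and> r < 1/4) (at_right 0)"
    by (auto simp: eventually_at_right_field intro!: exI[of _ "1/4"])
  ultimately have "eventually (\<lambda>r. ((\<eta> - 1/2 - r) powr \<alpha> / (\<eta> - 1/2 + r) powr \<alpha>)^2 > 1 - K \<and>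
      0 < r \<and> r < 1/4) (at_right 0)"
    by (rule eventually_conj)
  from eventually_happens'[OF trivial_limit_at_right_real this] obtain r where r: "0 < r" "r \<le> 1/4"
    "((\<eta> - 1/2 - r) powr \<alpha> / (\<eta> - 1/2 + r) powr \<alpha>)^2 \<ge> 1 - K"
    by (elim exE conjE) (auto intro: less_imp_le)
  define lr hr where "lr = (\<eta> - 1/2 - r) powr \<alpha>" and "hr = (\<eta> - 1/2 + r) powr \<alpha>"
  have lr: "0 < lr" using \<eta> r by (simp add: lr_def)
  have step: "(1 - K) * (a' i - a i)
      + K * (a' (cyc_pred m i) - a (cyc_pred m i)) + K * (a' (cyc_succ m i) - a (cyc_succ m i))
      \<le> tp a' i - tp a i"
    if a: "near r a" "near r a'" and le: "\<And>i. i \<in> {1..m} \<Longrightarrow> a i \<le> a' i" and i: "i \<in> {1..m}" for a a' i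
  proof -
    note [simp] = near_cube[OF a(1) r(2)] near_cube[OF a(2) r(2)]
    let ?p = "wpred a i" and ?q = "wsucc a i" and ?t = "a i"
    let ?p' = "wpred a' i" and ?q' = "wsucc a' i" and ?t' = "a' i"
    note ip = cyc_pred_mem[OF i] and su = cyc_succ_mem[OF i]
    note na = nearD[OF a(1) i] nearD[OF a(2) i] nearD[OF a(1) ip] nearD[OF a(2) ip]
      nearD[OF a(1) su] nearD[OF a(2) su]
    have t: "1/4 \<le> ?t" "?t \<le> 3/4" "1/4 \<le> ?t'" "?t' \<le> 3/4" using na r by auto
    have b: "lo \<le> ?p" "lo \<le> ?q" "lo \<le> ?p'" "lo \<le> ?q'" "?p \<le> hi" "?q \<le> hi" "?p' \<le> hi" "?q' \<le> hi"
      unfolding lo_def hi_def by (intro weights_bounds i, simp)+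
    have br: "lr \<le> ?p'" "lr \<le> ?q'" "?p' \<le> hr" "?q' \<le> hr"
      using na r \<eta> \<alpha> by (auto simp: wpred_def wsucc_def lr_def hr_def intro!: powr_mono2)
    have dp: "\<kappa> * (a' (cyc_pred m i) - a (cyc_pred m i)) \<le> ?p' - ?p"
      using \<kappa>(2)[of "\<eta> - 1 + a (cyc_pred m i)" "\<eta> - 1 + a' (cyc_pred m i)"] na le[OF ip] r
      by (simp add: wpred_def)
    have dq: "\<kappa> * (a' (cyc_succ m i) - a (cyc_succ m i)) \<le> ?q - ?q'"
      using \<kappa>(2)[of "\<eta> - a' (cyc_succ m i)" "\<eta> - a (cyc_succ m i)"] na le[OF su] r
      by (simp add: wsucc_def)
    have pp: "?p \<le> ?p'" and qq: "?q' \<le> ?q"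
      using dp dq \<kappa>(1) le[OF ip] le[OF su]
      by (smt (verit) mult_nonneg_nonneg)+
    let ?k = "3/16 * lo / hi^2"
    have k: "0 \<le> ?k" using lo by simp
    have "K * (a' (cyc_pred m i) - a (cyc_pred m i)) \<le> (\<kappa> * ?k) * (a' (cyc_pred m i) - a (cyc_pred m i))"
      using le[OF ip] K(3) by (intro mult_right_mono) auto
    also have "\<dots> = (\<kappa> * (a' (cyc_pred m i) - a (cyc_pred m i))) * ?k" by (simp only: mult_ac)
    also have "\<dots> \<le> (?p' - ?p) * ?k" using dp k by (rule mult_right_mono)
    also have "\<dots> \<le> share ?p' ?q ?t - share ?p ?q ?t"
      using share_weight_growth[OF lo b(1) pp b(7) b(2) b(6) t(1,2)] .
    finally have 1: "K * (a' (cyc_pred m i) - a (cyc_pred m i)) \<le> share ?p' ?q ?t - share ?p ?q ?t" .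
    have "K * (a' (cyc_succ m i) - a (cyc_succ m i)) \<le> (\<kappa> * ?k) * (a' (cyc_succ m i) - a (cyc_succ m i))"
      using le[OF su] K(3) by (intro mult_right_mono) auto
    also have "\<dots> = (\<kappa> * (a' (cyc_succ m i) - a (cyc_succ m i))) * ?k" by (simp only: mult_ac)
    also have "\<dots> \<le> (?q - ?q') * ?k" using dq k by (rule mult_right_mono)
    \<comment> \<open>A smaller successor weight is treated by exchanging the two vertices: it
      lowers the probability of the other vertex.\<close>
    also have "\<dots> \<le> share ?q ?p' (1 - ?t) - share ?q' ?p' (1 - ?t)"
      using share_weight_growth[OF lo b(4) qq b(6) b(3) b(7), of "1 - ?t"] t by simp
    also have "\<dots> = share ?p' ?q' ?t - share ?p' ?q ?t"
      using share_compl[of ?p' ?q' ?t] share_compl[of ?p' ?q ?t] lo b t by simp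
    finally have 2: "K * (a' (cyc_succ m i) - a (cyc_succ m i)) \<le> share ?p' ?q' ?t - share ?p' ?q ?t" .
    have "(1 - K) * (?t' - ?t) \<le> (lr / hr)^2 * (?t' - ?t)"
      using r(3) le[OF i] by (intro mult_right_mono) (auto simp: lr_def hr_def)
    also have "\<dots> \<le> share ?p' ?q' ?t' - share ?p' ?q' ?t"
      using share_arg_growth[OF lr br(1,3,2,4), of ?t ?t'] t le[OF i] by (simp add: mult.commute)
    finally show ?thesis using 1 2 by (simp add: tp_def)
  qed
  have "expanding r K" unfolding expanding_def
  proof (intro conjI allI impI ballI r K)
    fix a a' i assume a: "near r a \<and> near r a' \<and> (\<forall>i\<in>{1..m}. a i \<le> a' i)" and i: "i \<in> {1..m}"
    then have "0 \<le> (1 - K) * (a' i - a i)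
      + K * (a' (cyc_pred m i) - a (cyc_pred m i)) + K * (a' (cyc_succ m i) - a (cyc_succ m i))"
      using K cyc_pred_mem[OF i] cyc_succ_mem[OF i] by (intro add_nonneg_nonneg mult_nonneg_nonneg) auto
    then show "tp a i \<le> tp a' i" using step[of a a' i] a i by auto
  next
    fix a a' assume a: "near r a \<and> near r a' \<and> (\<forall>i\<in>{1..m}. a i \<le> a' i)"
    let ?e = "\<lambda>i. a' i - a i"
    have "(\<Sum>i\<in>{1..m}. (1 - K) * ?e i + K * ?e (cyc_pred m i) + K * ?e (cyc_succ m i))
        \<le> (\<Sum>i\<in>{1..m}. tp a' i - tp a i)"
      using step[of a a'] a by (intro sum_mono) auto
    also have "(\<Sum>i\<in>{1..m}. (1 - K) * ?e i + K * ?e (cyc_pred m i) + K * ?e (cyc_succ m i))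
        = (1 + K) * (\<Sum>i\<in>{1..m}. ?e i)"
      using sum_cyc_pred[of ?e m] sum_cyc_succ[of ?e m]
      by (simp only: sum.distrib sum_distrib_left[symmetric]) (simp add: algebra_simps)
    finally show "(1 + K) * (\<Sum>i\<in>{1..m}. ?e i) \<le> (\<Sum>i\<in>{1..m}. tp a' i - tp a i)" .
  qed
  then show ?thesis by blast
qed

end


section \<open>The transition kernel and its monotone coupling\<close>

lemma expectation_finite_mono:
  fixes f g :: "'b \<Rightarrow> real"
  assumes "finite (set_pmf p)" "\<And>x. x \<in> set_pmf p \<Longrightarrow> f x \<le> g x"
  shows "measure_pmf.expectation p f \<le> measure_pmf.expectation p g"
  using assms by (intro integral_mono_AE integrable_measure_pmf_finite) (auto simp: AE_measure_pmf_iff)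

lemma finite_set_Pi_pmf:
  "finite A \<Longrightarrow> (\<And>i. i \<in> A \<Longrightarrow> finite (set_pmf (p i))) \<Longrightarrow> finite (set_pmf (Pi_pmf A d p))"
  by (rule finite_subset[OF set_Pi_pmf_subset']) (auto intro!: finite_PiE_dflt)

lemma expectation_Pi_component:
  fixes f :: "'c \<Rightarrow> real"
  assumes "finite A" "i \<in> A"
  shows "measure_pmf.expectation (Pi_pmf A d p) (\<lambda>b. f (b i)) = measure_pmf.expectation (p i) f"
proof -
  have "measure_pmf.expectation (p i) f = measure_pmf.expectation (map_pmf (\<lambda>b. b i) (Pi_pmf A d p)) f"
    using assms by (simp add: Pi_pmf_component)
  then show ?thesis by simp
qed

lemma bernoulli_conj:
  assumes "0 \<le> s" "s \<le> 1" "0 \<le> t" "t \<le> 1"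
  shows "map_pmf (\<lambda>(c, b). c \<and> b) (pair_pmf (bernoulli_pmf s) (bernoulli_pmf t)) = bernoulli_pmf (s * t)"
proof -
  let ?p = "map_pmf (\<lambda>(c, b). c \<and> b) (pair_pmf (bernoulli_pmf s) (bernoulli_pmf t))"
  have "(\<lambda>(c, b). c \<and> b) -` {True} = {(True, True)}" by auto
  then have "pmf ?p True = s * t"
    using assms by (simp add: pmf_map measure_pmf_single pmf_pair)
  moreover have "s * t \<le> 1" using assms by (intro mult_le_one) auto
  ultimately have "pmf ?p True = pmf (bernoulli_pmf (s * t)) True" using assms by simp
  then show ?thesis
    by (intro pmf_eqI) (metis (full_types) pmf_False_conv_True)
qed

context cycle_dynamics
begin

definition kernel :: "(nat \<Rightarrow> real) \<Rightarrow> (nat \<Rightarrow> bool) pmf" where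
  "kernel a = Pi_pmf {1..m} False (\<lambda>i. bernoulli_pmf (tp a i))"

text \<open>Walk \<open>i\<close> chooses the vertex \<open>i\<close> at time \<open>n + 1\<close> iff \<open>b i\<close>.\<close>

definition step :: "nat \<Rightarrow> (nat \<Rightarrow> real) \<Rightarrow> (nat \<Rightarrow> bool) \<Rightarrow> nat \<Rightarrow> real" where
  "step n a b i = ((real n + 2) * a i + of_bool (b i)) / (real n + 3)"

lemma finite_kernel: "finite (set_pmf (kernel a))"
  unfolding kernel_def by (intro finite_set_Pi_pmf) (auto intro: finite_subset[OF subset_UNIV])

lemma expectation_kernel_component:
  assumes "a \<in> cube" "i \<in> {1..m}"
  shows "measure_pmf.expectation (kernel a) (\<lambda>b. of_bool (b i) :: real) = tp a i"
  using assms tp_bounds[OF assms] unfolding kernel_def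
  by (subst expectation_Pi_component[where f = of_bool]) auto

text \<open>Thinning: the lower copy follows the upper one in choosing \<open>i\<close> only if an
  independent coin of bias \<open>tp a i / tp a' i\<close> succeeds. This has the right marginals
  when \<open>tp a i \<le> tp a' i\<close> and \<open>0 < tp a' i\<close>.\<close>

definition coupling :: "(nat \<Rightarrow> real) \<Rightarrow> (nat \<Rightarrow> real) \<Rightarrow> (nat \<Rightarrow> bool \<times> bool) pmf" where
  "coupling a a' = Pi_pmf {1..m} (False, False)
     (\<lambda>i. map_pmf (\<lambda>(c, b). (c \<and> b, b)) (pair_pmf (bernoulli_pmf (tp a i / tp a' i)) (bernoulli_pmf (tp a' i))))"

lemma finite_coupling: "finite (set_pmf (coupling a a'))"
  unfolding coupling_def by (intro finite_set_Pi_pmf) (auto intro: finite_subset[OF subset_UNIV])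

lemma coupling_monotone:
  assumes "z \<in> set_pmf (coupling a a')" "fst (z i)"
  shows "snd (z i)"
proof -
  have "z \<in> PiE_dflt {1..m} (False, False) (set_pmf \<circ>
     (\<lambda>i. map_pmf (\<lambda>(c, b). (c \<and> b, b)) (pair_pmf (bernoulli_pmf (tp a i / tp a' i)) (bernoulli_pmf (tp a' i)))))"
    using assms(1) unfolding coupling_def by (intro subsetD[OF set_Pi_pmf_subset']) auto
  then show ?thesis using assms(2)
    by (cases "i \<in> {1..m}") (force simp: PiE_dflt_def)+
qed

lemma coupling_marginals:
  assumes a: "a \<in> cube" "a' \<in> cube" and le: "\<And>i. i \<in> {1..m} \<Longrightarrow> tp a i \<le> tp a' i"
    and pos: "\<And>i. i \<in> {1..m} \<Longrightarrow> 0 < tp a' i"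
  shows "map_pmf (\<lambda>z i. fst (z i)) (coupling a a') = kernel a"
    and "map_pmf (\<lambda>z i. snd (z i)) (coupling a a') = kernel a'"
proof -
  let ?J = "\<lambda>i. map_pmf (\<lambda>(c, b). (c \<and> b, b))
    (pair_pmf (bernoulli_pmf (tp a i / tp a' i)) (bernoulli_pmf (tp a' i)))"
  have "map_pmf (\<lambda>z. fst \<circ> z) (coupling a a') = Pi_pmf {1..m} False (\<lambda>i. map_pmf fst (?J i))"
    unfolding coupling_def by (rule Pi_pmf_map[symmetric]) auto
  also have "\<dots> = kernel a" unfolding kernel_def
  proof (rule Pi_pmf_cong)
    fix i assume i: "i \<in> {1..m}"
    have "map_pmf fst (?J i) =
        map_pmf (\<lambda>(c, b). c \<and> b) (pair_pmf (bernoulli_pmf (tp a i / tp a' i)) (bernoulli_pmf (tp a' i)))"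
      by (auto simp: map_pmf_comp intro!: map_pmf_cong)
    also have "\<dots> = bernoulli_pmf (tp a i)"
      using tp_bounds[OF a(1) i] tp_bounds[OF a(2) i] le[OF i] pos[OF i]
      by (subst bernoulli_conj) auto
    finally show "map_pmf fst (?J i) = bernoulli_pmf (tp a i)" .
  qed simp_all
  finally show "map_pmf (\<lambda>z i. fst (z i)) (coupling a a') = kernel a" by (simp add: o_def)
  have "map_pmf (\<lambda>z. snd \<circ> z) (coupling a a') = Pi_pmf {1..m} False (\<lambda>i. map_pmf snd (?J i))"
    unfolding coupling_def by (rule Pi_pmf_map[symmetric]) auto
  also have "\<dots> = kernel a'" unfolding kernel_def
  proof (rule Pi_pmf_cong)
    fix i assume i: "i \<in> {1..m}"
    have "map_pmf snd (?J i) =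
        map_pmf snd (pair_pmf (bernoulli_pmf (tp a i / tp a' i)) (bernoulli_pmf (tp a' i)))"
      by (auto simp: map_pmf_comp intro!: map_pmf_cong)
    then show "map_pmf snd (?J i) = bernoulli_pmf (tp a' i)" by (simp add: map_snd_pair_pmf)
  qed simp_all
  finally show "map_pmf (\<lambda>z i. snd (z i)) (coupling a a') = kernel a'" by (simp add: o_def)
qed

lemma expectation_coupling:
  fixes f g :: "(nat \<Rightarrow> bool) \<Rightarrow> real"
  assumes "a \<in> cube" "a' \<in> cube" "\<And>i. i \<in> {1..m} \<Longrightarrow> tp a i \<le> tp a' i"
    "\<And>i. i \<in> {1..m} \<Longrightarrow> 0 < tp a' i"
  shows "measure_pmf.expectation (kernel a) f + measure_pmf.expectation (kernel a') g =
    measure_pmf.expectation (coupling a a') (\<lambda>z. f (\<lambda>i. fst (z i)) + g (\<lambda>i. snd (z i)))"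
proof -
  have int: "integrable (measure_pmf (coupling a a')) h" for h :: "_ \<Rightarrow> real"
    by (intro integrable_measure_pmf_finite finite_coupling)
  have "measure_pmf.expectation (kernel a) f = measure_pmf.expectation (coupling a a') (\<lambda>z. f (\<lambda>i. fst (z i)))"
    by (simp only: coupling_marginals(1)[OF assms, symmetric] integral_map_pmf)
  moreover have "measure_pmf.expectation (kernel a') g = measure_pmf.expectation (coupling a a') (\<lambda>z. g (\<lambda>i. snd (z i)))"
    by (simp only: coupling_marginals(2)[OF assms, symmetric] integral_map_pmf)
  ultimately show ?thesis
    by (simp add: Bochner_Integration.integral_add[OF int int])
qed

lemma expectation_coupling_gap:
  assumes "a \<in> cube" "a' \<in> cube" "\<And>i. i \<in> {1..m} \<Longrightarrow> tp a i \<le> tp a' i"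
    "\<And>i. i \<in> {1..m} \<Longrightarrow> 0 < tp a' i"
  shows "measure_pmf.expectation (coupling a a')
      (\<lambda>z. \<Sum>i\<in>{1..m}. of_bool (snd (z i)) - of_bool (fst (z i)) :: real) =
    (\<Sum>i\<in>{1..m}. tp a' i - tp a i)"
proof -
  have int: "integrable (measure_pmf (coupling a a')) h" for h :: "_ \<Rightarrow> real"
    by (intro integrable_measure_pmf_finite finite_coupling)
  have "measure_pmf.expectation (coupling a a') (\<lambda>z. of_bool (fst (z i)) :: real) = tp a i"
    "measure_pmf.expectation (coupling a a') (\<lambda>z. of_bool (snd (z i)) :: real) = tp a' i"
    if "i \<in> {1..m}" for i
    using expectation_kernel_component[OF assms(1) that] expectation_kernel_component[OF assms(2) that]
    by (simp_all only: coupling_marginals[OF assms, symmetric] integral_map_pmf)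
  then show ?thesis
    by (subst Bochner_Integration.integral_sum[OF int])
      (auto intro!: sum.cong simp: Bochner_Integration.integral_diff[OF int int])
qed


section \<open>The uniform point is left\<close>

text \<open>Follows from \<open>ln (1 + 1 / N) \<le> 1 / N\<close> and
  \<open>1 + x \<le> exp x\<close>. It turns the loss factor of one step into a ratio of powers that
  telescopes over many steps.\<close>

lemma power_ratio_bound:
  fixes N s :: real
  assumes "N > 0" "s \<ge> 0"
  shows "1 - s / N \<le> (N / (N + 1)) powr s"
proof -
  have "1 - s / N = 1 + s * (- (1 / N))" by simp
  also have "\<dots> \<le> 1 + s * ln (N / (N + 1))"
  proof -
    have "ln (1 + 1 / N) \<le> 1 / N" using assms by (intro ln_add_one_self_le_self) auto
    moreover have "N / (N + 1) = inverse (1 + 1 / N)" using assms by (simp add: field_simps)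
    ultimately have "- (1 / N) \<le> ln (N / (N + 1))" using assms by (simp add: ln_inverse add_pos_pos)
    then show ?thesis using assms(2) by (intro add_left_mono mult_left_mono) auto
  qed
  also have "\<dots> \<le> exp (s * ln (N / (N + 1)))" by (rule exp_ge_add_one_self)
  also have "\<dots> = (N / (N + 1)) powr s" using assms by (simp add: powr_def)
  finally show ?thesis .
qed

text \<open>The right side is the chord of the convex function \<open>1 / (y + J)\<close> over the
  interval from 0 to \<open>k\<close>. Being affine in \<open>J\<close>, it reduces an expectation
  to the mean of \<open>J\<close>.\<close>

lemma inverse_add_le:
  fixes y J k :: real
  assumes "y > 0" "0 \<le> J" "J \<le> k"
  shows "1 / (y + J) \<le> 1 / y - J / (y * (y + k))"
proof -
  have "1 / y - 1 / (y + J) = J / (y * (y + J))" using assms by (simp add: field_simps)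
  moreover have "J / (y * (y + k)) \<le> J / (y * (y + J))"
    using assms by (intro divide_left_mono mult_left_mono mult_pos_pos) auto
  ultimately show ?thesis by linarith
qed

text \<open>For occupation states \<open>(real n + 2) * a i\<close> is one plus a visit count, so
  the gap compares counts rather than proportions; its increments are determined by the choices
  alone.\<close>

definition gap :: "nat \<Rightarrow> (nat \<Rightarrow> real) \<Rightarrow> (nat \<Rightarrow> real) \<Rightarrow> real" where
  "gap n a a' = (real n + 2) * (\<Sum>i\<in>{1..m}. a' i - a i)"

lemma gap_step:
  "gap (Suc n) (step n a b) (step n a' b') =
     gap n a a' + (\<Sum>i\<in>{1..m}. of_bool (b' i) - of_bool (b i))"
proof -
  have "(\<Sum>i\<in>{1..m}. step n a' b' i - step n a b i) =
      (\<Sum>i\<in>{1..m}. ((real n + 2) * (a' i - a i) + (of_bool (b' i) - of_bool (b i))) / (real n + 3))"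
    by (intro sum.cong) (auto simp: step_def diff_divide_distrib[symmetric] algebra_simps)
  also have "\<dots> = ((real n + 2) * (\<Sum>i\<in>{1..m}. a' i - a i) +
      (\<Sum>i\<in>{1..m}. of_bool (b' i) - of_bool (b i))) / (real n + 3)"
    by (simp only: sum_divide_distrib[symmetric] sum.distrib sum_distrib_left[symmetric])
  finally have "(real n + 3) * (\<Sum>i\<in>{1..m}. step n a' b' i - step n a b i) =
      (real n + 2) * (\<Sum>i\<in>{1..m}. a' i - a i) + (\<Sum>i\<in>{1..m}. of_bool (b' i) - of_bool (b i))"
    by (simp only: times_divide_eq_right) (simp add: field_simps)
  moreover have "real (Suc n) + 2 = real n + 3" by simp
  ultimately show ?thesis by (simp only: gap_def)
qed

text \<open>
  Under the coupling the gap \<open>T\<close> never decreases and grows on average like \<open>n powr (1 + c)\<close> as long as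
  both states are near the uniform point, where \<open>T \<le> m * (n + 2)\<close>. The supermartingale expressing
  this is \<open>(n + 2) / (T - m + c)\<close>; subtracting \<open>m - c\<close> makes up for the jumps of \<open>T\<close>, which may be as large
  as \<open>m\<close>.
\<close>

lemma gap_potential_step:
  fixes c T :: real and n :: nat
  assumes c: "0 < c" "c \<le> 1" and T: "real m \<le> T" and E: "(1 + c) * T / (real n + 2) \<le> EJ"
  shows "(real n + 3) * (1 / (T - m + c) - EJ / ((T - m + c) * (T + c)))
    \<le> (real n + 2) * (1 / (T - m + c)) * (1 - (c / 2) / (real n + 2))"
proof -
  define N y where "N = real n + 2" and "y = T - m + c"
  have N: "N > 0" and y: "y > 0" and T0: "T \<ge> 3" using T c m by (auto simp: N_def y_def)
  \<comment> \<open>\<open>T \<ge> 3\<close> absorbs the shift of \<open>T\<close> by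
    \<open>c\<close> at the price of half the excess growth rate.\<close>
  have "(1 + c / 2) * c \<le> 3/2 * c" using c by (intro mult_right_mono) auto
  also have "\<dots> \<le> c / 2 * T" using c T0 mult_left_mono[of 3 T "c / 2"] by simp
  finally have "(1 + c / 2) * (T + c) \<le> (1 + c) * T" by (simp add: field_simps)
  then have "(1 + c / 2) \<le> (1 + c) * T / (T + c)" using c T0 by (simp add: field_simps)
  then have "(1 + c / 2) / N \<le> (1 + c) * T / (T + c) / N" using N by (intro divide_right_mono) auto
  also have "\<dots> = (1 + c) * T / N / (T + c)" by simp
  also have "\<dots> \<le> EJ / (T + c)" using E c T0 by (intro divide_right_mono) (auto simp: N_def)
  finally have e: "(1 + c / 2) / N \<le> EJ / (T + c)" .
  have "(N + 1) * (1 - EJ / (T + c)) \<le> (N + 1) * (1 - (1 + c / 2) / N)"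
    using e N by (intro mult_left_mono) auto
  also have "\<dots> = N - c / 2 - (1 + c / 2) / N" using N by (simp add: field_simps)
  also have "\<dots> \<le> N * (1 - (c / 2) / N)" using N c by (simp add: field_simps)
  finally have "(N + 1) * (1 - EJ / (T + c)) / y \<le> N * (1 - (c / 2) / N) / y"
    using y by (intro divide_right_mono) auto
  moreover have "1 / y - EJ / (y * (T + c)) = (1 - EJ / (T + c)) / y"
    by (simp add: diff_divide_distrib divide_divide_eq_left mult.commute[of y])
  moreover have "real n + 3 = N + 1" by (simp add: N_def)
  ultimately show ?thesis by (simp only: N_def[symmetric] y_def[symmetric]) simp
qed

text \<open>\<open>M\<close> is the number of steps for which the coupled copies are followed. The
  sum can exceed \<open>q\<close> only while both states are near; the excess is paid for by the
  potential, whose mean shrinks at least by the factor \<open>1 - (c / 2) / (n + 2)\<close> in each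
  step.\<close>

lemma coupled_pair_bound:
  fixes h :: "nat \<Rightarrow> (nat \<Rightarrow> real) \<Rightarrow> real"
  assumes ex: "expanding r c"
    and h0: "\<And>n a. 0 \<le> h n a" and hq: "\<And>n a. h n a \<le> q"
    and off: "\<And>n a. \<not> near r a \<Longrightarrow> h n a = 0"
    and sub: "\<And>n a. near r a \<Longrightarrow> h n a \<le> measure_pmf.expectation (kernel a) (\<lambda>b. h (Suc n) (step n a b))"
    and le: "\<And>i. i \<in> {1..m} \<Longrightarrow> a i \<le> a' i" and T: "real m \<le> gap n a a'"
  shows "h n a + h n a' \<le> q + q * m * ((real n + 2) / (gap n a a' - m + c)) *
           ((real n + 2) / (real n + 2 + real M)) powr (c / 2)"
  using le T
proof (induction M arbitrary: n a a')
  case (0 n a a')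
  note q0 = order_trans[OF h0 hq]
  have r: "r \<le> 1/4" and c: "0 < c" "c \<le> 1" using ex by (auto simp: expanding_def)
  let ?y = "gap n a a' - m + c"
  have y: "0 < ?y" using 0(2) c by simp
  show ?case
  proof (cases "near r a \<and> near r a'")
    case True
    have "(\<Sum>i\<in>{1..m}. a' i - a i) \<le> (\<Sum>i\<in>{1..m}. 1)"
    proof (intro sum_mono)
      fix i assume "i \<in> {1..m}"
      then show "a' i - a i \<le> 1" using nearD[of r a i] nearD[of r a' i] True r by linarith
    qed
    then have "gap n a a' \<le> (real n + 2) * m" unfolding gap_def by (intro mult_left_mono) auto
    then have "?y \<le> m * (real n + 2)" using m c by (simp add: mult.commute)
    \<comment> \<open>Both proportions lie in the unit interval, so \<open>m\<close> times the
      potential is at least 1 and pays for the second \<open>q\<close>.\<close>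
    then have "1 \<le> m * ((real n + 2) / ?y)" using y by (simp add: field_simps)
    then have "q * 1 \<le> q * (m * ((real n + 2) / ?y))" by (intro mult_left_mono q0)
    moreover have "h n a + h n a' \<le> q + q" by (intro add_mono hq)
    ultimately show ?thesis by (simp add: mult.assoc)
  next
    case False
    then have "h n a + h n a' \<le> q" using off[of a n] off[of a' n] hq[of n a] hq[of n a'] q0 by auto
    also have "0 \<le> q * m * ((real n + 2) / ?y)" using y q0 by auto
    ultimately show ?thesis by simp
  qed
next
  case (Suc M n a a')
  note q0 = order_trans[OF h0 hq]
  have r: "r \<le> 1/4" and c: "0 < c" "c \<le> 1" using ex by (auto simp: expanding_def)
  define T where "T = gap n a a'"
  define y where "y = T - m + c"
  define N where "N = real n + 2"
  have y: "0 < y" and N: "0 < N" using Suc.prems(2) c by (auto simp: y_def T_def N_def)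
  show ?case
  proof (cases "near r a \<and> near r a'")
    case False
    then have "h n a + h n a' \<le> q" using off[of a n] off[of a' n] hq[of n a] hq[of n a'] q0 by auto
    also have "0 \<le> q * m * (N / y) * ((real n + 2) / (real n + 2 + real (Suc M))) powr (c / 2)"
      using y N q0 by auto
    ultimately show ?thesis by (simp add: N_def y_def T_def)
  next
    case True
    then have cu: "a \<in> cube" "a' \<in> cube" using near_cube r by auto
    have tple: "\<And>i. i \<in> {1..m} \<Longrightarrow> tp a i \<le> tp a' i"
      and EJ: "(1 + c) * (\<Sum>i\<in>{1..m}. a' i - a i) \<le> (\<Sum>i\<in>{1..m}. tp a' i - tp a i)"
      using ex True Suc.prems(1) unfolding expanding_def by blast+
    have tppos: "0 < tp a' i" if "i \<in> {1..m}" for i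
    proof -
      have "0 < (\<eta> - 1) powr \<alpha> / (4 * \<eta> powr \<alpha>)" using \<eta> by simp
      then show ?thesis using tp_near_bounds(1)[of r a' i] True r that by linarith
    qed
    let ?E = "measure_pmf.expectation (coupling a a')"
    let ?J = "\<lambda>z. \<Sum>i\<in>{1..m}. of_bool (snd (z i)) - of_bool (fst (z i)) :: real"
    have int: "integrable (measure_pmf (coupling a a')) h" for h :: "_ \<Rightarrow> real"
      by (intro integrable_measure_pmf_finite finite_coupling)
    define R where "R = ((N + 1) / (N + 1 + real M)) powr (c / 2)"
    have R: "0 \<le> R" by (simp add: R_def)
    have "h n a + h n a' \<le> measure_pmf.expectation (kernel a) (\<lambda>b. h (Suc n) (step n a b))
        + measure_pmf.expectation (kernel a') (\<lambda>b. h (Suc n) (step n a' b))"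
      using True by (intro add_mono sub) auto
    also have "\<dots> = ?E (\<lambda>z. h (Suc n) (step n a (\<lambda>i. fst (z i))) + h (Suc n) (step n a' (\<lambda>i. snd (z i))))"
      by (rule expectation_coupling[OF cu tple tppos])
    also have "\<dots> \<le> ?E (\<lambda>z. q + q * m * R * ((N + 1) * (1 / y - ?J z / (y * (y + m)))))"
    proof (rule expectation_finite_mono[OF finite_coupling])
      fix z assume z: "z \<in> set_pmf (coupling a a')"
      let ?b = "\<lambda>i. fst (z i)" and ?b' = "\<lambda>i. snd (z i)"
      have zi: "of_bool (fst (z i)) \<le> (of_bool (snd (z i)) :: real)" for i
        using coupling_monotone[OF z, of i] by auto
      have J: "0 \<le> ?J z" "?J z \<le> m"
      proof -
        show "0 \<le> ?J z" using zi by (intro sum_nonneg) simp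
        have "?J z \<le> (\<Sum>i\<in>{1..m}. 1)" by (intro sum_mono) (auto simp: of_bool_def)
        then show "?J z \<le> m" by simp
      qed
      have g: "gap (Suc n) (step n a ?b) (step n a' ?b') = T + ?J z"
        by (simp add: gap_step T_def)
      have "h (Suc n) (step n a ?b) + h (Suc n) (step n a' ?b')
          \<le> q + q * m * ((real (Suc n) + 2) / (gap (Suc n) (step n a ?b) (step n a' ?b') - m + c)) *
           ((real (Suc n) + 2) / (real (Suc n) + 2 + real M)) powr (c / 2)"
      proof (rule Suc.IH)
        show "step n a ?b i \<le> step n a' ?b' i" if "i \<in> {1..m}" for i
          unfolding step_def using Suc.prems(1)[OF that] zi[of i]
          by (intro divide_right_mono add_mono mult_left_mono) auto
        show "real m \<le> gap (Suc n) (step n a ?b) (step n a' ?b')"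
          using g J(1) Suc.prems(2) by (simp add: T_def)
      qed
      also have "\<dots> = q + q * m * R * ((N + 1) * (1 / (y + ?J z)))"
        by (simp add: g R_def N_def y_def algebra_simps)
      \<comment> \<open>The chord bound makes the estimate affine in the increment
        \<open>?J z\<close>, so only its mean \<open>expectation_coupling_gap\<close>
        enters.\<close>
      also have "\<dots> \<le> q + q * m * R * ((N + 1) * (1 / y - ?J z / (y * (y + m))))"
        using inverse_add_le[OF y J] N R q0 by (intro add_left_mono mult_left_mono) auto
      finally show "h (Suc n) (step n a ?b) + h (Suc n) (step n a' ?b')
          \<le> q + q * m * R * ((N + 1) * (1 / y - ?J z / (y * (y + m))))" .
    qed
    also have "\<dots> = q + q * m * R * ((N + 1) * (1 / y - ?E ?J / (y * (y + m))))"
      using int by simp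
    also have "\<dots> = q + q * m * R * ((N + 1) * (1 / y - (\<Sum>i\<in>{1..m}. tp a' i - tp a i) / (y * (y + m))))"
      by (simp only: expectation_coupling_gap[OF cu tple tppos])
    also have "\<dots> \<le> q + q * m * R * (N * (1 / y) * (1 - (c / 2) / N))"
    proof -
      have "(1 + c) * T / (real n + 2) \<le> (\<Sum>i\<in>{1..m}. tp a' i - tp a i)"
        using EJ by (simp add: T_def gap_def)
      from gap_potential_step[OF c _ this] Suc.prems(2)
      have "(N + 1) * (1 / y - (\<Sum>i\<in>{1..m}. tp a' i - tp a i) / (y * (y + m)))
          \<le> N * (1 / y) * (1 - (c / 2) / N)"
        by (simp add: T_def N_def y_def add_ac)
      then show ?thesis using R q0 by (intro add_left_mono mult_left_mono) auto
    qed
    also have "\<dots> \<le> q + q * m * R * (N * (1 / y) * (N / (N + 1)) powr (c / 2))"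
      using power_ratio_bound[OF N, of "c / 2"] c N y R q0
      by (intro add_left_mono mult_left_mono) auto
    also have "\<dots> = q + q * m * (N / y) * ((N / (N + 1)) powr (c / 2) * R)" by simp
    also have "(N / (N + 1)) powr (c / 2) * R = (N / (N + real (Suc M))) powr (c / 2)"
      unfolding R_def using N by (subst powr_mult[symmetric]) (auto simp: add_ac)
    finally show ?thesis by (simp add: N_def y_def T_def)
  qed
qed

text \<open>Letting \<open>M\<close> tend to infinity, ordered pairs with gap at least
  \<open>m\<close> satisfy \<open>h n a + h n a' \<le> q\<close>. The two successors reached when
  all walks avoid, or all walks choose, their own vertex form such a pair, so their deficits
  relative to \<open>q\<close> add up to at least \<open>q\<close>. Each has probability at least
  \<open>\<rho>\<close>, which costs every near state \<open>\<rho> * q\<close>.\<close>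

lemma subsolution_zero:
  fixes h :: "nat \<Rightarrow> (nat \<Rightarrow> real) \<Rightarrow> real"
  assumes ex: "expanding r c"
    and h0: "\<And>n a. 0 \<le> h n a" and h1: "\<And>n a. h n a \<le> 1"
    and off: "\<And>n a. \<not> near r a \<Longrightarrow> h n a = 0"
    and sub: "\<And>n a. near r a \<Longrightarrow> h n a \<le> measure_pmf.expectation (kernel a) (\<lambda>b. h (Suc n) (step n a b))"
  shows "h n a = 0"
proof -
  define q where "q = (SUP (n, a). h n a)"
  have bdd: "bdd_above (range (\<lambda>(n, a). h n a))" using h1 by (intro bdd_aboveI[of _ 1]) auto
  have hq: "h n a \<le> q" for n a
    unfolding q_def using cSUP_upper[OF _ bdd, of "(n, a)"] by simp
  have q0: "0 \<le> q" using h0[of 0 undefined] hq[of 0 undefined] by linarith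
  have r: "r \<le> 1/4" and c: "0 < c" using ex by (auto simp: expanding_def)
  have pair: "h n a + h n a' \<le> q"
    if "\<And>i. i \<in> {1..m} \<Longrightarrow> a i \<le> a' i" "real m \<le> gap n a a'" for n a a'
  proof (rule tendsto_lowerbound)
    have "(\<lambda>M. ((real n + 2) / (real n + 2 + real M)) powr (c / 2)) \<longlonglongrightarrow> 0 powr (c / 2)"
    proof (rule tendsto_powr2)
      show "(\<lambda>M. (real n + 2) / (real n + 2 + real M)) \<longlonglongrightarrow> 0" by real_asymp
    qed (use c in auto)
    then have "(\<lambda>M. ((real n + 2) / (real n + 2 + real M)) powr (c / 2)) \<longlonglongrightarrow> 0"
      by simp
    from tendsto_add[OF tendsto_const[of q] tendsto_mult[OF tendsto_const[of
        "q * m * ((real n + 2) / (gap n a a' - m + c))"] this]]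
    show "(\<lambda>M. q + q * m * ((real n + 2) / (gap n a a' - m + c)) *
           ((real n + 2) / (real n + 2 + real M)) powr (c / 2)) \<longlonglongrightarrow> q"
      by (simp only: mult_zero_right add_0_right)
    show "\<forall>\<^sub>F M in sequentially. h n a + h n a' \<le> q + q * m * ((real n + 2) / (gap n a a' - m + c)) *
           ((real n + 2) / (real n + 2 + real M)) powr (c / 2)"
      using coupled_pair_bound[where h = h and q = q, OF ex h0 hq off sub that] by simp
    show "sequentially \<noteq> bot" by simp
  qed
  define p0 where "p0 = (\<eta> - 1) powr \<alpha> / (4 * \<eta> powr \<alpha>)"
  define \<rho> where "\<rho> = p0 ^ m"
  have p0: "0 < p0" using \<eta> by (simp add: p0_def)
  have \<rho>: "0 < \<rho>" using p0 by (simp add: \<rho>_def)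
  have contract: "h n a \<le> q - \<rho> * q" if a: "near r a" for n a
  proof -
    let ?F = "\<lambda>_::nat. False" and ?A = "\<lambda>i. i \<in> {1..m}"
    let ?f = "\<lambda>b. h (Suc n) (step n a b)"
    have cu: "a \<in> cube" using near_cube a r by auto
    have FA: "?F \<noteq> ?A" using m by (auto simp: fun_eq_iff intro!: exI[of _ 1])
    have "\<rho> = (\<Prod>i\<in>{1..m}. p0)" by (simp add: \<rho>_def)
    also have "\<dots> \<le> (\<Prod>i\<in>{1..m}. pmf (bernoulli_pmf (tp a i)) False)"
      using tp_bounds[OF cu] tp_near_bounds(2)[OF a r] p0 by (intro prod_mono) (auto simp: p0_def)
    also have "\<dots> = pmf (kernel a) ?F" unfolding kernel_def by (subst pmf_Pi') (auto intro!: prod.cong)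
    finally have pF: "\<rho> \<le> pmf (kernel a) ?F" .
    have "\<rho> = (\<Prod>i\<in>{1..m}. p0)" by (simp add: \<rho>_def)
    also have "\<dots> \<le> (\<Prod>i\<in>{1..m}. pmf (bernoulli_pmf (tp a i)) True)"
      using tp_bounds[OF cu] tp_near_bounds(1)[OF a r] p0 by (intro prod_mono) (auto simp: p0_def)
    also have "\<dots> = pmf (kernel a) ?A" unfolding kernel_def by (subst pmf_Pi') (auto intro!: prod.cong)
    finally have pA: "\<rho> \<le> pmf (kernel a) ?A" .
    have int: "integrable (measure_pmf (kernel a)) g" for g :: "_ \<Rightarrow> real"
      by (intro integrable_measure_pmf_finite finite_kernel)
    have nonneg: "0 \<le> (q - ?f b) * pmf (kernel a) b" for b using hq[of "Suc n"] by simp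
    have pr: "?f ?F + ?f ?A \<le> q"
    proof (rule pair)
      show "step n a ?F i \<le> step n a ?A i" for i
        unfolding step_def by (intro divide_right_mono add_mono) auto
      \<comment> \<open>All \<open>m\<close> choices differ, so the gap is exactly \<open>m\<close>,
        the smallest value that the pair bound admits.\<close>
      have "(\<Sum>i\<in>{1..m}. step n a ?A i - step n a ?F i) = (\<Sum>i\<in>{1..m}. 1 / (real n + 3))"
        by (intro sum.cong) (auto simp: step_def diff_divide_distrib[symmetric])
      then show "real m \<le> gap (Suc n) (step n a ?F) (step n a ?A)" by (simp add: gap_def field_simps)
    qed
    have "\<rho> * q \<le> \<rho> * ((q - ?f ?F) + (q - ?f ?A))" using pr \<rho> by (intro mult_left_mono) auto
    also have "\<dots> = (q - ?f ?F) * \<rho> + (q - ?f ?A) * \<rho>" by (simp add: algebra_simps)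
    also have "\<dots> \<le> (q - ?f ?F) * pmf (kernel a) ?F + (q - ?f ?A) * pmf (kernel a) ?A"
      using pF pA hq by (intro add_mono mult_left_mono) auto
    also have "\<dots> = (\<Sum>b\<in>{?F, ?A}. (q - ?f b) * pmf (kernel a) b)"
      by (subst sum.insert) (use FA in auto)
    also have "\<dots> \<le> (\<Sum>b\<in>set_pmf (kernel a) \<union> {?F, ?A}. (q - ?f b) * pmf (kernel a) b)"
      using nonneg finite_kernel by (intro sum_mono2) auto
    also have "\<dots> = measure_pmf.expectation (kernel a) (\<lambda>b. q - ?f b)"
      using finite_kernel by (intro integral_measure_pmf_real[symmetric]) auto
    also have "\<dots> = q - measure_pmf.expectation (kernel a) ?f" using int by simp
    finally show ?thesis using sub[OF a, of n] by linarith
  qed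
  \<comment> \<open>States that are not near have \<open>h = 0\<close>; for the bound to cover them
    its right side must be nonnegative, which evaluation at the uniform state shows.\<close>
  have "0 \<le> q - \<rho> * q"
  proof -
    have "h 0 (\<lambda>_. 1/2) \<le> q - \<rho> * q" using contract[of "\<lambda>_. 1/2" 0] ex by (simp add: near_def expanding_def)
    then show ?thesis using h0[of 0 "\<lambda>_. 1/2"] by linarith
  qed
  then have "h n a \<le> q - \<rho> * q" for n a using contract[of a n] off[of a n] by (cases "near r a") auto
  then have "q \<le> q - \<rho> * q" unfolding q_def[symmetric]
    by (subst (1) q_def) (auto intro!: cSUP_least)
  then have "\<rho> * q \<le> 0" by simp
  then have "q = 0" using \<rho> q0 by (simp add: mult_le_0_iff)
  then show ?thesis using h0[of n a] hq[of n a] by simp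
qed

end


section \<open>Summability of the defects\<close>

text \<open>Summability against \<open>1/n\<close> alone would permit rare large values. The
  increment bound makes the increments of the squares summable, so \<open>b\<close> converges, and a
  positive limit contradicts the divergence of the harmonic series.\<close>

lemma tendsto_zero_if_harmonic_summable:
  fixes b :: "nat \<Rightarrow> real"
  assumes nonneg: "\<And>n. 0 \<le> b n"
    and incr: "\<And>n. \<bar>b (Suc n) - b n\<bar> \<le> C / (real n + 3)"
    and sm: "summable (\<lambda>n. b n / (real n + 3))"
  shows "b \<longlonglongrightarrow> 0"
proof -
  have C: "0 \<le> C" using order_trans[OF abs_ge_zero incr[of 0]] by simp
  have sq: "summable (\<lambda>n. 1 / (real n + 3)^2)"
    using summable_ignore_initial_segment[OF inverse_power_summable[of 2, where 'a = real], of 3]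
    by (simp add: field_simps)
  have "summable (\<lambda>n. (b (Suc n))^2 - (b n)^2)"
  proof (rule summable_comparison_test)
    show "summable (\<lambda>n. 2 * C * (b n / (real n + 3)) + C^2 * (1 / (real n + 3)^2))"
      by (intro summable_add summable_mult sm sq)
    have "\<bar>(b (Suc n))^2 - (b n)^2\<bar> \<le> 2 * C * (b n / (real n + 3)) + C^2 * (1 / (real n + 3)^2)" for n
    proof -
      have "(b (Suc n))^2 - (b n)^2 = (b (Suc n) - b n) * (b (Suc n) + b n)"
        by (simp add: power2_eq_square algebra_simps)
      then have "\<bar>(b (Suc n))^2 - (b n)^2\<bar> = \<bar>b (Suc n) - b n\<bar> * (b (Suc n) + b n)"
        using nonneg[of n] nonneg[of "Suc n"] by (simp add: abs_mult)
      also have "\<dots> \<le> C / (real n + 3) * (2 * b n + C / (real n + 3))"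
        using incr[of n] nonneg[of n] nonneg[of "Suc n"] C by (intro mult_mono) auto
      also have "\<dots> = 2 * C * (b n / (real n + 3)) + C^2 * (1 / (real n + 3)^2)"
        by (simp add: power2_eq_square distrib_left)
      finally show ?thesis .
    qed
    then show "\<exists>N. \<forall>n\<ge>N. norm ((b (Suc n))^2 - (b n)^2) \<le>
        2 * C * (b n / (real n + 3)) + C^2 * (1 / (real n + 3)^2)" by auto
  qed
  then have "convergent (\<lambda>n. \<Sum>k<n. (b (Suc k))^2 - (b k)^2)"
    by (simp add: summable_iff_convergent)
  then have "convergent (\<lambda>n. (b n)^2 - (b 0)^2)" by (simp add: sum_lessThan_telescope[of "\<lambda>n. (b n)^2"])
  then have "convergent (\<lambda>n. ((b n)^2 - (b 0)^2) + (b 0)^2)" by (intro convergent_add convergent_const)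
  then obtain l where l: "(\<lambda>n. (b n)^2) \<longlonglongrightarrow> l" by (auto simp: convergent_def)
  have "(\<lambda>n. sqrt ((b n)^2)) \<longlonglongrightarrow> sqrt l" by (intro tendsto_intros l)
  then have lim: "b \<longlonglongrightarrow> sqrt l" using nonneg by simp
  have "sqrt l = 0"
  proof (rule ccontr)
    assume "sqrt l \<noteq> 0"
    moreover have "0 \<le> sqrt l" using lim nonneg by (intro tendsto_lowerbound[OF lim]) auto
    ultimately have pos: "0 < sqrt l" by simp
    then have "eventually (\<lambda>n. b n > sqrt l / 2) sequentially"
      by (intro order_tendstoD(1)[OF lim]) auto
    then obtain N where N: "\<And>n. n \<ge> N \<Longrightarrow> b n > sqrt l / 2" by (auto simp: eventually_sequentially)
    have "summable (\<lambda>n. (sqrt l / 2) / (real n + 3))"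
      using sm
    proof (rule summable_comparison_test[rotated], intro exI allI impI)
      fix n assume "n \<ge> N"
      then have "sqrt l / 2 / (real n + 3) \<le> b n / (real n + 3)"
        using N[of n] by (intro divide_right_mono) auto
      then show "norm (sqrt l / 2 / (real n + 3)) \<le> b n / (real n + 3)" using pos by simp
    qed
    then have "summable (\<lambda>n. (2 / sqrt l) * ((sqrt l / 2) / (real n + 3)))" by (rule summable_mult)
    moreover have "(\<lambda>n. (2 / sqrt l) * ((sqrt l / 2) / (real n + 3))) = (\<lambda>n. inverse (real (n + 3)))"
      using pos by (intro ext) (simp add: divide_simps)
    ultimately have "summable (\<lambda>n. inverse (real (n + 3)))" by (simp only:)
    then have "summable (\<lambda>n. inverse (real n))" by (rule summable_iff_shift[THEN iffD1])
    then show False using not_summable_harmonic[where 'a = real] by (simp add: inverse_eq_divide)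
  qed
  with lim show ?thesis by simp
qed

context cycle_dynamics
begin

lemma step_diff:
  assumes "a \<in> cube" "i \<in> {1..m}"
  shows "step n a b i = a i + (of_bool (b i) - a i) / (real n + 3)"
    and "\<bar>of_bool (b i) - a i\<bar> \<le> 1" "\<bar>step n a b i - a i\<bar> \<le> 1 / (real n + 3)"
proof -
  show 1: "step n a b i = a i + (of_bool (b i) - a i) / (real n + 3)"
    by (simp add: step_def field_simps)
  show 2: "\<bar>of_bool (b i) - a i\<bar> \<le> 1" using cubeD[OF assms] by (auto simp: of_bool_def abs_le_iff)
  have "\<bar>of_bool (b i) - a i\<bar> / (real n + 3) \<le> 1 / (real n + 3)"
    using 2 by (intro divide_right_mono) auto
  then show "\<bar>step n a b i - a i\<bar> \<le> 1 / (real n + 3)" by (simp add: 1)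
qed

lemma defect_bounds:
  assumes "a \<in> cube" "i \<in> {1..m}"
  shows "0 \<le> defect m a i"
  using cubeD[OF assms] by (simp add: defect_def)

text \<open>\<open>t * (1 - t)\<close> changes by at most \<open>\<gamma>\<close>, the squared
  neighbour expression by at most \<open>4 * \<gamma>\<close>, and both factors are at most 1; hence
  the constant 5.\<close>

lemma defect_lipschitz:
  assumes a: "a \<in> cube" "a' \<in> cube" and i: "i \<in> {1..m}"
    and d: "\<And>j. j \<in> {1..m} \<Longrightarrow> \<bar>a' j - a j\<bar> \<le> \<gamma>"
  shows "\<bar>defect m a' i - defect m a i\<bar> \<le> 5 * \<gamma>"
proof -
  note ip = cyc_pred_mem[OF i] and su = cyc_succ_mem[OF i]
  define D where "D = a (cyc_pred m i) + a (cyc_succ m i) - 1"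
  define D' where "D' = a' (cyc_pred m i) + a' (cyc_succ m i) - 1"
  let ?t = "a i" and ?t' = "a' i"
  note b = cubeD[OF a(1) i] cubeD[OF a(2) i] cubeD[OF a(1) ip] cubeD[OF a(2) ip]
    cubeD[OF a(1) su] cubeD[OF a(2) su]
  have g: "0 \<le> \<gamma>" using order_trans[OF abs_ge_zero d[OF i]] .
  have D: "\<bar>D\<bar> \<le> 1" "\<bar>D'\<bar> \<le> 1" using b by (auto simp: D_def D'_def abs_le_iff)
  have "\<bar>?t' * (1 - ?t') - ?t * (1 - ?t)\<bar> = \<bar>?t' - ?t\<bar> * \<bar>1 - ?t - ?t'\<bar>"
    by (simp add: abs_mult[symmetric] algebra_simps)
  also have "\<dots> \<le> \<gamma> * 1" using d[OF i] b g by (intro mult_mono) (auto simp: abs_le_iff)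
  finally have 1: "\<bar>?t' * (1 - ?t') - ?t * (1 - ?t)\<bar> \<le> \<gamma>" by simp
  have "\<bar>D'^2 - D^2\<bar> = \<bar>D' - D\<bar> * \<bar>D' + D\<bar>"
    by (simp add: abs_mult[symmetric] power2_eq_square algebra_simps)
  also have "\<dots> \<le> (2 * \<gamma>) * 2"
  proof (intro mult_mono)
    have "\<bar>D' - D\<bar> \<le> \<bar>a' (cyc_pred m i) - a (cyc_pred m i)\<bar> + \<bar>a' (cyc_succ m i) - a (cyc_succ m i)\<bar>"
      by (auto simp: D_def D'_def abs_if)
    then show "\<bar>D' - D\<bar> \<le> 2 * \<gamma>" using d[OF ip] d[OF su] by linarith
    show "\<bar>D' + D\<bar> \<le> 2" using D by linarith
  qed (use g in auto)
  finally have 2: "\<bar>D'^2 - D^2\<bar> \<le> 4 * \<gamma>" by simp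
  have D2: "\<bar>D'^2\<bar> \<le> 1" using D by (simp add: abs_square_le_1)
  have t: "\<bar>?t * (1 - ?t)\<bar> \<le> 1" using b by (auto simp: abs_mult intro!: mult_le_one)
  have "defect m a' i - defect m a i =
      (?t' * (1 - ?t') - ?t * (1 - ?t)) * D'^2 + ?t * (1 - ?t) * (D'^2 - D^2)"
    by (simp add: defect_def D_def D'_def algebra_simps)
  then have "\<bar>defect m a' i - defect m a i\<bar> \<le>
      \<bar>?t' * (1 - ?t') - ?t * (1 - ?t)\<bar> * \<bar>D'^2\<bar> + \<bar>?t * (1 - ?t)\<bar> * \<bar>D'^2 - D^2\<bar>"
    by (metis abs_mult abs_triangle_ineq)
  also have "\<dots> \<le> \<gamma> * 1 + 1 * (4 * \<gamma>)"
    using 1 2 D2 t g by (intro add_mono mult_mono) auto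
  finally show ?thesis by simp
qed

section \<open>The energy and its expected increase\<close>

definition energy :: "(nat \<Rightarrow> real) \<Rightarrow> real" where
  "energy a = (\<Sum>i\<in>{1..m}. (a i - 1/2) * (a (cyc_succ m i) - 1/2))"

lemma energy_bound:
  assumes "a \<in> cube"
  shows "\<bar>energy a\<bar> \<le> m"
proof -
  have "\<bar>energy a\<bar> \<le> (\<Sum>i\<in>{1..m}. \<bar>(a i - 1/2) * (a (cyc_succ m i) - 1/2)\<bar>)"
    unfolding energy_def by (rule sum_abs)
  also have "\<dots> \<le> (\<Sum>i\<in>{1..m}. 1)"
  proof (intro sum_mono)
    fix i assume i: "i \<in> {1..m}"
    show "\<bar>(a i - 1/2) * (a (cyc_succ m i) - 1/2)\<bar> \<le> 1"
      using cubeD[OF assms i] cubeD[OF assms cyc_succ_mem[OF i]]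
      unfolding abs_mult by (intro mult_le_one) (auto simp: abs_le_iff)
  qed
  finally show ?thesis by simp
qed

text \<open>The energy is quadratic, so its expansion is exact: the first-order term is the step
  along the gradient, and the second-order term is at least \<open>- m\<close> times the squared
  step size.\<close>

lemma energy_step_ge:
  assumes a: "a \<in> cube"
  shows "energy a + (1 / (real n + 3)) * (\<Sum>i\<in>{1..m}. (of_bool (b i) - a i) * (a (cyc_pred m i) + a (cyc_succ m i) - 1))
           - m * (1 / (real n + 3))^2 \<le> energy (step n a b)"
proof -
  define \<gamma> where "\<gamma> = 1 / (real n + 3)"
  define v where "v = (\<lambda>i. of_bool (b i) - a i)"
  define e where "e = (\<lambda>i. a i - 1/2)"
  let ?s = "cyc_succ m"
  have st: "step n a b i = a i + \<gamma> * v i" if "i \<in> {1..m}" for i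
    using step_diff(1)[OF a that] by (simp add: \<gamma>_def v_def)
  have "energy (step n a b) = (\<Sum>i\<in>{1..m}. (e i + \<gamma> * v i) * (e (?s i) + \<gamma> * v (?s i)))"
    unfolding energy_def using cyc_succ_mem
    by (intro sum.cong refl) (simp add: st e_def algebra_simps del: atLeastAtMost_iff One_nat_def)
  also have "\<dots> = (\<Sum>i\<in>{1..m}. e i * e (?s i) + \<gamma> * (v i * e (?s i)) + \<gamma> * (v (?s i) * e i) + \<gamma>^2 * (v i * v (?s i)))"
    by (intro sum.cong refl) (simp add: algebra_simps power2_eq_square)
  also have "\<dots> = energy a + \<gamma> * (\<Sum>i\<in>{1..m}. v i * e (?s i)) + \<gamma> * (\<Sum>i\<in>{1..m}. v (?s i) * e i)
      + \<gamma>^2 * (\<Sum>i\<in>{1..m}. v i * v (?s i))"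
    by (simp only: sum.distrib sum_distrib_left[symmetric]) (simp add: energy_def e_def)
  \<comment> \<open>A shift of the index pairs \<open>v i\<close> with both neighbours; the two
    halves \<open>1/2\<close> then combine to the \<open>- 1\<close> of the neighbour
    expression.\<close>
  also have "(\<Sum>i\<in>{1..m}. v (?s i) * e i) = (\<Sum>i\<in>{1..m}. v i * e (cyc_pred m i))"
    using sum_cyc_succ[of "\<lambda>i. v i * e (cyc_pred m i)" m]
    by (simp add: cyc_pred_succ del: atLeastAtMost_iff One_nat_def cong: sum.cong)
  finally have E: "energy (step n a b) = energy a + \<gamma> * (\<Sum>i\<in>{1..m}. v i * e (?s i))
      + \<gamma> * (\<Sum>i\<in>{1..m}. v i * e (cyc_pred m i)) + \<gamma>^2 * (\<Sum>i\<in>{1..m}. v i * v (?s i))" .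
  have "(\<Sum>i\<in>{1..m}. -1) \<le> (\<Sum>i\<in>{1..m}. v i * v (?s i))"
  proof (intro sum_mono)
    fix i assume i: "i \<in> {1..m}"
    have "\<bar>v i * v (?s i)\<bar> \<le> 1"
      using step_diff(2)[OF a i, of b] step_diff(2)[OF a cyc_succ_mem[OF i], of b]
      unfolding abs_mult v_def by (intro mult_le_one) auto
    then show "-1 \<le> v i * v (?s i)" by (simp add: abs_le_iff)
  qed
  then have "\<gamma>^2 * (- real m) \<le> \<gamma>^2 * (\<Sum>i\<in>{1..m}. v i * v (?s i))"
    by (intro mult_left_mono) auto
  moreover have S: "(\<Sum>i\<in>{1..m}. (of_bool (b i) - a i) * (a (cyc_pred m i) + a (?s i) - 1)) =
      (\<Sum>i\<in>{1..m}. v i * e (?s i)) + (\<Sum>i\<in>{1..m}. v i * e (cyc_pred m i))"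
    unfolding sum.distrib[symmetric] by (intro sum.cong refl) (simp add: e_def v_def algebra_simps)
  ultimately show ?thesis
    unfolding S E \<gamma>_def[symmetric] by (simp add: distrib_left mult.commute)
qed

definition total_defect :: "(nat \<Rightarrow> real) \<Rightarrow> real" where
  "total_defect a = (\<Sum>i\<in>{1..m}. defect m a i)"

lemma expected_energy_step:
  "\<exists>c>0. \<forall>n. \<forall>a\<in>cube. energy a + c * (total_defect a / (real n + 3)) - m * (1 / (real n + 3))^2
     \<le> measure_pmf.expectation (kernel a) (\<lambda>b. energy (step n a b))"
proof -
  obtain c where c: "c > 0" "\<And>a i. a \<in> cube \<Longrightarrow> i \<in> {1..m} \<Longrightarrow>
      c * defect m a i \<le> (tp a i - a i) * (a (cyc_pred m i) + a (cyc_succ m i) - 1)"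
    using drift_lower_bound by blast
  show ?thesis
  proof (intro exI[of _ c] conjI c(1) allI ballI)
    fix n a assume a: "a \<in> cube"
    let ?d = "\<lambda>i. a (cyc_pred m i) + a (cyc_succ m i) - 1"
    let ?\<gamma> = "1 / (real n + 3)"
    have int: "integrable (measure_pmf (kernel a)) g" for g :: "_ \<Rightarrow> real"
      by (intro integrable_measure_pmf_finite finite_kernel)
    have "c * total_defect a = (\<Sum>i\<in>{1..m}. c * defect m a i)" by (simp add: total_defect_def sum_distrib_left)
    also have "\<dots> \<le> (\<Sum>i\<in>{1..m}. (tp a i - a i) * ?d i)" using c(2)[OF a] by (intro sum_mono)
    finally have "?\<gamma> * (c * total_defect a) \<le> ?\<gamma> * (\<Sum>i\<in>{1..m}. (tp a i - a i) * ?d i)"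
      by (intro mult_left_mono) auto
    moreover have "measure_pmf.expectation (kernel a) (\<lambda>b. \<Sum>i\<in>{1..m}. (of_bool (b i) - a i) * ?d i)
        = (\<Sum>i\<in>{1..m}. (tp a i - a i) * ?d i)"
      using expectation_kernel_component[OF a] int
      by (subst Bochner_Integration.integral_sum[OF int]) (auto intro!: sum.cong)
    ultimately have "energy a + c * (total_defect a / (real n + 3)) - m * ?\<gamma>^2 \<le>
        measure_pmf.expectation (kernel a) (\<lambda>b. energy a + ?\<gamma> * (\<Sum>i\<in>{1..m}. (of_bool (b i) - a i) * ?d i) - m * ?\<gamma>^2)"
      using int by simp
    also have "\<dots> \<le> measure_pmf.expectation (kernel a) (\<lambda>b. energy (step n a b))"
      by (intro expectation_finite_mono finite_kernel energy_step_ge a)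
    finally show "energy a + c * (total_defect a / (real n + 3)) - m * (1 / (real n + 3))^2
        \<le> measure_pmf.expectation (kernel a) (\<lambda>b. energy (step n a b))" .
  qed
qed

text \<open>
  For \<open>m\<close> not divisible by 4 a state with all coordinates mixed and small defects is close to the
  uniform point, so a path with vanishing defects cannot leave a neighbourhood of this point by small steps.
\<close>

lemma trapped_or_unmixed:
  assumes m4: "\<not> 4 dvd m" and r: "0 < r" "r \<le> 1/4"
    and cu: "\<And>n. x n \<in> cube"
    and st: "\<And>n i. i \<in> {1..m} \<Longrightarrow> \<bar>x (Suc n) i - x n i\<bar> \<le> 1 / (real n + 3)"
    and df: "(\<lambda>n. total_defect (x n)) \<longlonglongrightarrow> 0"
    and leave: "\<not> (\<exists>N. \<forall>k. near r (x (N + k)))"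
  shows "(\<lambda>n. \<Prod>i\<in>{1..m}. x n i * (1 - x n i)) \<longlonglongrightarrow> 0"
proof (rule LIMSEQ_I)
  fix \<epsilon> :: real assume \<epsilon>: "0 < \<epsilon>"
  \<comment> \<open>3/16 is the minimum of \<open>t * (1 - t)\<close> on [1/4, 3/4], so every state
    within \<open>r \<le> 1/4\<close> of the uniform point meets the threshold
    \<open>\<epsilon>'\<close>.\<close>
  define \<epsilon>' where "\<epsilon>' = min \<epsilon> (3/16)"
  have \<epsilon>': "0 < \<epsilon>'" "\<epsilon>' \<le> \<epsilon>" "\<epsilon>' \<le> 3/16" using \<epsilon> by (auto simp: \<epsilon>'_def)
  \<comment> \<open>Dividing a defect below \<open>\<delta>\<close> by \<open>\<epsilon>'\<close>
    bounds the neighbour expression by \<open>r / (4 * m)\<close>, which \<open>near_half\<close>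
    turns into distance \<open>r / 4\<close>.\<close>
  define \<delta> where "\<delta> = \<epsilon>' * (r / (4 * m))^2"
  have \<delta>: "0 < \<delta>" using \<epsilon>' r m by (simp add: \<delta>_def)
  let ?P = "\<lambda>n. \<Prod>i\<in>{1..m}. x n i * (1 - x n i)"
  have u: "0 \<le> x n i * (1 - x n i)" "x n i * (1 - x n i) \<le> 1" if "i \<in> {1..m}" for n i
    using cubeD[OF cu that, of n] by (auto intro: mult_le_one)
  have "eventually (\<lambda>n. total_defect (x n) < \<delta>) sequentially" by (rule order_tendstoD(2)[OF df \<delta>])
  moreover have "eventually (\<lambda>n. 1 / (real n + 3) < r / 2) sequentially"
  proof (rule order_tendstoD(2))
    show "(\<lambda>n. 1 / (real n + 3)) \<longlonglongrightarrow> 0" by real_asymp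
  qed (use r in auto)
  ultimately have "eventually (\<lambda>n. total_defect (x n) < \<delta> \<and> 1 / (real n + 3) < r / 2) sequentially"
    by (rule eventually_conj)
  then obtain N where N: "\<And>n. n \<ge> N \<Longrightarrow> total_defect (x n) < \<delta> \<and> 1 / (real n + 3) < r / 2"
    unfolding eventually_sequentially by blast
  have close: "near (r / 4) (x n)" if n: "n \<ge> N" and mx: "\<And>i. i \<in> {1..m} \<Longrightarrow> \<epsilon>' \<le> x n i * (1 - x n i)" for n
    unfolding near_def
  proof
    fix i assume i: "i \<in> {1..m}"
    have "\<bar>x n (cyc_pred m j) + x n (cyc_succ m j) - 1\<bar> \<le> r / (4 * m)" if j: "j \<in> {1..m}" for j
    proof -
      let ?d = "x n (cyc_pred m j) + x n (cyc_succ m j) - 1"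
      have "\<epsilon>' * ?d^2 \<le> x n j * (1 - x n j) * ?d^2" by (intro mult_right_mono mx j) auto
      also have "\<dots> = defect m (x n) j" by (simp add: defect_def)
      also have "\<dots> \<le> total_defect (x n)"
        unfolding total_defect_def using j by (intro member_le_sum) (auto intro: defect_bounds[OF cu])
      also have "\<dots> \<le> \<delta>" using N[OF n] by simp
      finally have "?d^2 \<le> (r / (4 * m))^2" using \<epsilon>'(1) by (simp add: \<delta>_def)
      then show ?thesis using r m by (subst (asm) abs_le_square_iff[symmetric]) auto
    qed
    from near_half[OF m m4 i this] show "\<bar>x n i - 1/2\<bar> \<le> r / 4" using m by simp
  qed
  have next_near: "near r (x (Suc n))" if n: "n \<ge> N" and c: "near (r / 4) (x n)" for n
    unfolding near_def
  proof
    fix i assume i: "i \<in> {1..m}"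
    then show "\<bar>x (Suc n) i - 1/2\<bar> \<le> r"
      using st[OF i, of n] N[OF n] c[unfolded near_def, rule_format, OF i] r by linarith
  qed
  have stay: "near (r / 4) (x n)" if "n \<ge> N" "near r (x n)" for n
  proof (rule close[OF that(1)])
    fix i assume i: "i \<in> {1..m}"
    have t: "1/4 \<le> x n i" "x n i \<le> 3/4" using nearD[OF that(2) i] r by auto
    then have "0 \<le> (x n i - 1/4) * (3/4 - x n i)" by simp
    then have "3/16 \<le> x n i * (1 - x n i)" by (simp add: field_simps)
    then show "\<epsilon>' \<le> x n i * (1 - x n i)" using \<epsilon>' by simp
  qed
  have "?P n < \<epsilon>" if n: "n \<ge> N" for n
  proof (rule ccontr)
    assume "\<not> ?P n < \<epsilon>"
    have "\<epsilon>' \<le> x n i * (1 - x n i)" if i: "i \<in> {1..m}" for i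
    proof -
      have "?P n = x n i * (1 - x n i) * (\<Prod>j\<in>{1..m} - {i}. x n j * (1 - x n j))"
        using i by (subst prod.remove[of _ i]) auto
      also have "\<dots> \<le> x n i * (1 - x n i) * 1"
        using u i by (intro mult_left_mono prod_le_1) auto
      finally show ?thesis using \<open>\<not> ?P n < \<epsilon>\<close> \<epsilon>' by linarith
    qed
    from close[OF n this] have start: "near (r / 4) (x n)" by simp
    \<comment> \<open>One step may widen the radius from \<open>r / 4\<close> to at most
      \<open>r\<close>, but a state within \<open>r\<close> with small defects is already within
      \<open>r / 4\<close>.\<close>
    have "near (r / 4) (x (n + k))" for k
    proof (induction k)
      case (Suc k)
      then show ?case using stay[of "Suc (n + k)"] next_near[of "n + k"] n by simp
    qed (use start in simp)
    moreover have "near r a" if "near (r / 4) a" for a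
    proof -
      have "r / 4 \<le> r" using r by simp
      with that show ?thesis unfolding near_def by (blast intro: order_trans)
    qed
    ultimately have "\<forall>k. near r (x (n + k))" by blast
    with leave show False by blast
  qed
  moreover have "0 \<le> ?P n" for n by (intro prod_nonneg u) auto
  ultimately show "\<exists>N. \<forall>n\<ge>N. norm (?P n - 0) < \<epsilon>" by auto
qed

end


section \<open>The occupation process\<close>

context cycle_dynamics
begin

lemma diag_in_cube: "x \<in> state_space m \<Longrightarrow> diag x \<in> cube"
  using state_space_bounds by (auto simp: cube_def)

lemma trans_map_eq_tp:
  assumes x: "x \<in> state_space m" and i: "i \<in> {1..m}"
  shows "trans_map m \<eta> \<alpha> x i i = tp (diag x) i"
    and "trans_map m \<eta> \<alpha> x i (cyc_succ m i) = 1 - tp (diag x) i"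
proof -
  note cu = diag_in_cube[OF x]
  have Hi: "H m \<eta> \<alpha> x i i = wpred (diag x) i"
  proof -
    have "\<eta> - (1 - d) = \<eta> - 1 + d" for d by simp
    then show ?thesis by (simp only: H_def wpred_def state_space_pred[OF x i] refl if_True)
  qed
  have Hs: "H m \<eta> \<alpha> x i (cyc_succ m i) = wsucc (diag x) i"
    using cyc_succ_neq[OF m] by (simp add: H_def wsucc_def diag_def)
  note e = trans_map_def Hi Hs state_space_succ[OF x i] V_def
  show "trans_map m \<eta> \<alpha> x i i = tp (diag x) i"
    using i by (simp add: e tp_def share_def diag_def)
  show "trans_map m \<eta> \<alpha> x i (cyc_succ m i) = 1 - tp (diag x) i"
    using i share_compl[OF weights_pos[OF cu i]] cubeD[OF cu i]
    by (simp add: e tp_def share_def) (simp add: diag_def add.commute)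
qed

lemma Fix_eq: "Fix m \<eta> \<alpha> = {x \<in> state_space m. \<forall>i\<in>{1..m}. defect m (diag x) i = 0}"
proof -
  have "trans_map m \<eta> \<alpha> x = x \<longleftrightarrow> (\<forall>i\<in>{1..m}. tp (diag x) i = diag x i)" if x: "x \<in> state_space m" for x
  proof
    assume "trans_map m \<eta> \<alpha> x = x"
    then show "\<forall>i\<in>{1..m}. tp (diag x) i = diag x i"
      using trans_map_eq_tp(1)[OF x] by (metis diag_def)
  next
    assume fp: "\<forall>i\<in>{1..m}. tp (diag x) i = diag x i"
    show "trans_map m \<eta> \<alpha> x = x"
    proof (intro ext)
      fix i v
      consider "\<not> (i \<in> {1..m} \<and> v \<in> V m i)" | "i \<in> {1..m}" "v = i" | "i \<in> {1..m}" "v = cyc_succ m i"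
        by (auto simp: V_def)
      then show "trans_map m \<eta> \<alpha> x i v = x i v"
      proof cases
        case 1
        then have "x i v = 0" using x unfolding state_space_def by blast
        then show ?thesis using 1 by (simp only: trans_map_def if_False)
      next
        case 2
        then show ?thesis using trans_map_eq_tp(1)[OF x 2(1)] fp by (metis diag_def)
      next
        case 3
        then show ?thesis using trans_map_eq_tp(2)[OF x 3(1)] state_space_succ[OF x 3(1)] fp by simp
      qed
    qed
  qed
  then show ?thesis unfolding Fix_def using tp_fixed_iff[OF diag_in_cube] by blast
qed

end

locale occupation_process = cycle_dynamics m \<eta> \<alpha> + prob_space M
  for m \<eta> \<alpha> and M :: "'a measure" +
  fixes W :: "nat \<Rightarrow> nat \<Rightarrow> 'a \<Rightarrow> nat"
  assumes walks: "interacting_walks M m \<eta> \<alpha> W"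
begin

abbreviation Hist :: "nat \<Rightarrow> 'a measure" where
  "Hist n \<equiv> history M m W n"

definition X :: "nat \<Rightarrow> 'a \<Rightarrow> nat \<Rightarrow> real" where
  "X n \<omega> = diag (occupation m W n \<omega>)"

definition choice :: "nat \<Rightarrow> 'a \<Rightarrow> nat \<Rightarrow> bool" where
  "choice n \<omega> = (\<lambda>i. i \<in> {1..m} \<and> W i n \<omega> = i)"

text \<open>Fixing the value outside \<open>{1..m}\<close> makes the set of patterns finite and lets
  it contain the support of \<open>kernel\<close>.\<close>

definition choices :: "(nat \<Rightarrow> bool) set" where
  "choices = PiE_dflt {1..m} False (\<lambda>_. UNIV)"

lemma finite_choices: "finite choices"
  unfolding choices_def by (intro finite_PiE_dflt) auto

lemma choice_mem: "choice n \<omega> \<in> choices"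
  by (auto simp: choices_def choice_def PiE_dflt_def)

lemma choicesD: "b \<in> choices \<Longrightarrow> i \<notin> {1..m} \<Longrightarrow> \<not> b i"
  by (auto simp: choices_def PiE_dflt_def)

lemma W_measurable: "i \<in> {1..m} \<Longrightarrow> n \<ge> 1 \<Longrightarrow> W i n \<in> measurable M (count_space UNIV)"
  using walks by (simp only: interacting_walks_def)

lemma W_range: "i \<in> {1..m} \<Longrightarrow> n \<ge> 1 \<Longrightarrow> \<omega> \<in> space M \<Longrightarrow> W i n \<omega> \<in> V m i"
  using walks by (simp only: interacting_walks_def)

lemma walks_independent:
  "AE \<omega> in M. event_cond_prob M (Hist n) {\<omega>'\<in>space M. \<forall>i\<in>{1..m}. W i (n+1) \<omega>' \<in> A i} \<omega>
          = (\<Prod>i\<in>{1..m}. event_cond_prob M (Hist n) {\<omega>'\<in>space M. W i (n+1) \<omega>' \<in> A i} \<omega>)"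
proof -
  have "\<forall>n. \<forall>A :: nat \<Rightarrow> nat set. AE \<omega> in M.
        event_cond_prob M (Hist n) {\<omega>'\<in>space M. \<forall>i\<in>{1..m}. W i (n+1) \<omega>' \<in> A i} \<omega>
          = (\<Prod>i\<in>{1..m}. event_cond_prob M (Hist n) {\<omega>'\<in>space M. W i (n+1) \<omega>' \<in> A i} \<omega>)"
    using walks unfolding interacting_walks_def by (elim conjE)
  then show ?thesis by (elim allE)
qed

lemma occupation_state_space:
  assumes \<omega>: "\<omega> \<in> space M"
  shows "occupation m W n \<omega> \<in> state_space m"
proof -
  have s: "occupation m W n \<omega> i i + occupation m W n \<omega> i (cyc_succ m i) = 1" if i: "i \<in> {1..m}" for i
  proof -
    have "(\<Sum>k=1..n. of_bool (W i k \<omega> = i)) + (\<Sum>k=1..n. of_bool (W i k \<omega> = cyc_succ m i))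
        = (\<Sum>k=1..n. 1::real)"
      unfolding sum.distrib[symmetric]
    proof (intro sum.cong refl)
      fix k assume "k \<in> {1..n}"
      then have "W i k \<omega> \<in> V m i" using W_range[OF i _ \<omega>] by simp
      then show "of_bool (W i k \<omega> = i) + of_bool (W i k \<omega> = cyc_succ m i) = (1::real)"
        using cyc_succ_neq[OF m, of i] by (auto simp: V_def)
    qed
    then have "(1 + (\<Sum>k=1..n. of_bool (W i k \<omega> = i))) + (1 + (\<Sum>k=1..n. of_bool (W i k \<omega> = cyc_succ m i)))
        = 2 + real n" by simp
    then have "1 / (2 + real n) * ((1 + (\<Sum>k=1..n. of_bool (W i k \<omega> = i)))
        + (1 + (\<Sum>k=1..n. of_bool (W i k \<omega> = cyc_succ m i)))) = 1" by simp
    then show ?thesis using i by (simp only: occupation_def V_def distrib_left) simp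
  qed
  have "0 \<le> occupation m W n \<omega> i v" for i v
    by (auto simp: occupation_def intro!: divide_nonneg_nonneg add_nonneg_nonneg sum_nonneg)
  then show ?thesis using s by (auto simp: state_space_def occupation_def)
qed

lemma X_cube: "\<omega> \<in> space M \<Longrightarrow> X n \<omega> \<in> cube"
  unfolding X_def by (intro diag_in_cube occupation_state_space)

lemma X_0: "X 0 \<omega> = (\<lambda>i. if i \<in> {1..m} then 1/2 else 0)"
  by (auto simp: X_def diag_def occupation_def V_def)

lemma X_Suc: "X (Suc n) \<omega> = step n (X n \<omega>) (choice (Suc n) \<omega>)"
proof
  fix i
  show "X (Suc n) \<omega> i = step n (X n \<omega>) (choice (Suc n) \<omega>) i"
  proof (cases "i \<in> {1..m}")
    case True
    have "real (Suc n) + 2 = real n + 3" "real n + 2 \<noteq> 0" by auto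
    then show ?thesis using True
      by (simp add: X_def diag_def occupation_def V_def step_def choice_def add_ac)
  next
    case False
    then show ?thesis by (simp only: X_def diag_def occupation_def step_def choice_def) simp
  qed
qed

text \<open>Makes every real function of \<open>X n\<close> bounded; with the discrete measurability
  of \<open>X n\<close> it is integrable without any regularity of the function.\<close>

lemma X_range: "finite (range (X n))"
proof (induction n)
  case 0
  have "range (X 0) \<subseteq> {\<lambda>i. if i \<in> {1..m} then 1/2 else 0}" by (auto simp: X_0)
  then show ?case by (rule finite_subset) simp
next
  case (Suc n)
  have "range (X (Suc n)) \<subseteq> (\<lambda>(a, b). step n a b) ` (range (X n) \<times> choices)"
    using choice_mem by (auto simp: X_Suc)
  then show ?case by (rule finite_subset) (intro finite_imageI finite_cartesian_product Suc finite_choices)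
qed

lemma X_bounded:
  fixes g :: "(nat \<Rightarrow> real) \<Rightarrow> real"
  shows "\<exists>C. \<forall>\<omega>. \<bar>g (X n \<omega>)\<bar> \<le> C"
proof -
  have "finite ((\<lambda>a. \<bar>g a\<bar>) ` range (X n))" using X_range by blast
  then show ?thesis by (intro exI[of _ "Max ((\<lambda>a. \<bar>g a\<bar>) ` range (X n))"]) auto
qed

lemma space_Hist [simp]: "space (Hist n) = space M"
  by (simp add: history_def space_measure_of_conv)

lemma sets_Hist: "sets (Hist n) = sigma_sets (space M) {W i k -` A \<inter> space M | i k A. i \<in> {1..m} \<and> 1 \<le> k \<and> k \<le> n}"
  unfolding history_def by (intro sets_measure_of) auto

lemma subalgebra_Hist: "subalgebra M (Hist n)"
  unfolding subalgebra_def sets_Hist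
  using measurable_sets[OF W_measurable] by (auto intro!: sets.sigma_sets_subset)

lemma finite_subalgebra: "finite_measure_subalgebra M (Hist n)"
  by (intro finite_measure_subalgebra.intro finite_measure_axioms
      finite_measure_subalgebra_axioms.intro subalgebra_Hist)

lemma W_measurable_Hist:
  assumes "i \<in> {1..m}" "1 \<le> k" "k \<le> n"
  shows "W i k \<in> measurable (Hist n) (count_space UNIV)"
proof (rule measurableI)
  fix A :: "nat set"
  show "W i k -` A \<inter> space (Hist n) \<in> sets (Hist n)"
    unfolding sets_Hist space_Hist using assms by (intro sigma_sets.Basic) blast
qed simp

lemma choice_eq_iff:
  assumes "b \<in> choices"
  shows "choice k \<omega> = b \<longleftrightarrow> (\<forall>i\<in>{1..m}. (W i k \<omega> = i) = b i)"
  using choicesD[OF assms] by (auto simp: choice_def fun_eq_iff)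

lemma choice_measurable:
  assumes "1 \<le> k" "k \<le> n"
  shows "choice k \<in> measurable (Hist n) (count_space choices)"
  unfolding measurable_count_space_eq2[OF finite_choices]
proof (intro conjI ballI)
  show "choice k \<in> space (Hist n) \<rightarrow> choices" using choice_mem by auto
  fix b assume b: "b \<in> choices"
  have "{\<omega> \<in> space (Hist n). \<forall>i\<in>{1..m}. (W i k \<omega> = i) = b i} \<in> sets (Hist n)"
  proof (intro sets.sets_Collect_finite_All)
    fix i assume i: "i \<in> {1..m}"
    have "W i k -` (if b i then {i} else - {i}) \<inter> space (Hist n) \<in> sets (Hist n)"
      using W_measurable_Hist[OF i assms] by (rule measurable_sets) simp
    also have "W i k -` (if b i then {i} else - {i}) \<inter> space (Hist n) = {\<omega> \<in> space (Hist n). (W i k \<omega> = i) = b i}"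
      by auto
    finally show "{\<omega> \<in> space (Hist n). (W i k \<omega> = i) = b i} \<in> sets (Hist n)" .
  qed auto
  also have "{\<omega> \<in> space (Hist n). \<forall>i\<in>{1..m}. (W i k \<omega> = i) = b i} = choice k -` {b} \<inter> space (Hist n)"
    using choice_eq_iff[OF b] by auto
  finally show "choice k -` {b} \<inter> space (Hist n) \<in> sets (Hist n)" .
qed

lemma X_measurable_Hist: "k \<le> n \<Longrightarrow> X k \<in> measurable (Hist n) (count_space UNIV)"
proof (induction k)
  case 0
  then show ?case by (simp add: X_0[abs_def])
next
  case (Suc k)
  have "(\<lambda>\<omega>. step k (X k \<omega>) (choice (Suc k) \<omega>)) \<in> measurable (Hist n) (count_space UNIV)"
  proof (rule measurable_compose_countable'[OF _ choice_measurable])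
    fix b
    show "(\<lambda>\<omega>. step k (X k \<omega>) b) \<in> measurable (Hist n) (count_space UNIV)"
      using Suc by (intro measurable_compose[OF Suc.IH]) auto
  qed (use Suc.prems finite_choices in \<open>auto intro: countable_finite\<close>)
  then show ?case by (simp add: X_Suc[abs_def])
qed

lemma X_fun_measurable_Hist:
  fixes g :: "(nat \<Rightarrow> real) \<Rightarrow> real"
  shows "k \<le> n \<Longrightarrow> (\<lambda>\<omega>. g (X k \<omega>)) \<in> borel_measurable (Hist n)"
  by (rule measurable_compose[OF X_measurable_Hist]) auto

lemma X_fun_measurable:
  fixes g :: "(nat \<Rightarrow> real) \<Rightarrow> real"
  shows "(\<lambda>\<omega>. g (X k \<omega>)) \<in> borel_measurable M"
  using measurable_from_subalg[OF subalgebra_Hist X_fun_measurable_Hist[of k k]] by simp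

lemma X_fun_integrable:
  fixes g :: "(nat \<Rightarrow> real) \<Rightarrow> real"
  shows "integrable M (\<lambda>\<omega>. g (X k \<omega>))"
proof -
  obtain C where "\<And>\<omega>. \<bar>g (X k \<omega>)\<bar> \<le> C" using X_bounded[of g k] by blast
  then show ?thesis by (intro integrable_const_bound[of _ C] X_fun_measurable) auto
qed

lemma choice_event: "b \<in> choices \<Longrightarrow> {\<omega> \<in> space M. choice (Suc n) \<omega> = b} \<in> sets M"
  using measurable_sets[OF choice_measurable[of "Suc n" "Suc n"], of "{b}"]
    subalgebra_Hist[of "Suc n"]
  by (auto simp: subalgebra_def vimage_def Int_def conj_commute)

text \<open>Conditional independence, applied to the singletons of the vertices prescribed by
  \<open>b\<close>, turns the one-walk probabilities into the mass of the product measure.\<close>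

lemma choice_cond_prob:
  assumes b: "b \<in> choices"
  shows "AE \<omega> in M. real_cond_exp M (Hist n) (indicator {\<omega> \<in> space M. choice (Suc n) \<omega> = b}) \<omega>
           = pmf (kernel (X n \<omega>)) b"
proof -
  let ?v = "\<lambda>i. if b i then i else cyc_succ m i"
  let ?A = "\<lambda>i. {?v i}"
  have ev: "{\<omega> \<in> space M. choice (Suc n) \<omega> = b} = {\<omega> \<in> space M. \<forall>i\<in>{1..m}. W i (n + 1) \<omega> \<in> ?A i}"
  proof (intro Collect_cong conj_cong refl)
    fix \<omega> assume \<omega>: "\<omega> \<in> space M"
    have "(W i (n + 1) \<omega> = i) = b i \<longleftrightarrow> W i (n + 1) \<omega> \<in> ?A i" if "i \<in> {1..m}" for i
      using W_range[OF that _ \<omega>, of "n + 1"] cyc_succ_neq[OF m, of i] by (auto simp: V_def)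
    then show "choice (Suc n) \<omega> = b \<longleftrightarrow> (\<forall>i\<in>{1..m}. W i (n + 1) \<omega> \<in> ?A i)"
      unfolding choice_eq_iff[OF b] by simp
  qed
  have "AE \<omega> in M. event_cond_prob M (Hist n) {\<omega>'\<in>space M. \<forall>i\<in>{1..m}. W i (n+1) \<omega>' \<in> ?A i} \<omega>
          = (\<Prod>i\<in>{1..m}. event_cond_prob M (Hist n) {\<omega>'\<in>space M. W i (n+1) \<omega>' \<in> ?A i} \<omega>)"
    by (rule walks_independent)
  moreover have "AE \<omega> in M. \<forall>i\<in>{1..m}. event_cond_prob M (Hist n) {\<omega>'\<in>space M. W i (n+1) \<omega>' \<in> ?A i} \<omega>
      = trans_map m \<eta> \<alpha> (occupation m W n \<omega>) i (?v i)"
  proof (rule AE_finite_allI)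
    fix i assume i: "i \<in> {1..m}"
    have "?v i \<in> V m i" by (simp add: V_def)
    then have "AE \<omega> in M. event_cond_prob M (Hist n) {\<omega>'\<in>space M. W i (n+1) \<omega>' = ?v i} \<omega>
      = trans_map m \<eta> \<alpha> (occupation m W n \<omega>) i (?v i)"
      using walks i unfolding interacting_walks_def by blast
    then show "AE \<omega> in M. event_cond_prob M (Hist n) {\<omega>'\<in>space M. W i (n+1) \<omega>' \<in> ?A i} \<omega>
      = trans_map m \<eta> \<alpha> (occupation m W n \<omega>) i (?v i)"
      by (simp only: singleton_iff)
  qed simp
  ultimately show ?thesis
    using AE_space
  proof eventually_elim
    case (elim \<omega>)
    note st = occupation_state_space[OF elim(3), of n] and cu = X_cube[OF elim(3), of n]
    have "event_cond_prob M (Hist n) {\<omega> \<in> space M. choice (Suc n) \<omega> = b} \<omega>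
        = (\<Prod>i\<in>{1..m}. trans_map m \<eta> \<alpha> (occupation m W n \<omega>) i (?v i))"
      unfolding ev elim(1) using elim(2) by (intro prod.cong) auto
    also have "\<dots> = (\<Prod>i\<in>{1..m}. pmf (bernoulli_pmf (tp (X n \<omega>) i)) (b i))"
    proof (intro prod.cong refl)
      fix i assume i: "i \<in> {1..m}"
      show "trans_map m \<eta> \<alpha> (occupation m W n \<omega>) i (?v i) = pmf (bernoulli_pmf (tp (X n \<omega>) i)) (b i)"
        using trans_map_eq_tp[OF st i] tp_bounds[OF cu i] by (cases "b i") (auto simp: X_def)
    qed
    also have "\<dots> = pmf (kernel (X n \<omega>)) b"
      unfolding kernel_def using choicesD[OF b] by (subst pmf_Pi') auto
    finally show ?case by (simp only: event_cond_prob_def)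
  qed
qed

lemma set_kernel: "set_pmf (kernel a) \<subseteq> choices"
  unfolding kernel_def choices_def
  by (rule order_trans[OF set_Pi_pmf_subset']) (auto simp: PiE_dflt_def)

text \<open>Markov property in integrated form. Splitting by the finitely many values of the next
  choice leaves a history-measurable factor times an indicator, whose conditional probability is
  known.\<close>

lemma one_step:
  fixes f :: "(nat \<Rightarrow> real) \<Rightarrow> (nat \<Rightarrow> bool) \<Rightarrow> real"
  assumes E: "E \<in> sets (Hist n)"
  shows "expectation (\<lambda>\<omega>. indicator E \<omega> * f (X n \<omega>) (choice (Suc n) \<omega>)) =
    expectation (\<lambda>\<omega>. indicator E \<omega> * measure_pmf.expectation (kernel (X n \<omega>)) (f (X n \<omega>)))"
proof -
  interpret finite_measure_subalgebra M "Hist n" by (rule finite_subalgebra)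
  let ?S = "\<lambda>b. {\<omega> \<in> space M. choice (Suc n) \<omega> = b}"
  let ?g = "\<lambda>b \<omega>. indicator E \<omega> * f (X n \<omega>) b :: real"
  have EM: "E \<in> sets M" using E subalgebra_Hist by (auto simp: subalgebra_def)
  have gm: "?g b \<in> borel_measurable (Hist n)" for b
    using E X_fun_measurable_Hist[of n n "\<lambda>a. f a b"] by measurable
  have gi: "integrable M (\<lambda>\<omega>. ?g b \<omega> * indicator S \<omega>)" if "S \<in> sets M" for b S
  proof -
    obtain C where C: "\<And>\<omega>. \<bar>f (X n \<omega>) b\<bar> \<le> C" using X_bounded[of "\<lambda>a. f a b" n] by blast
    have "\<bar>?g b \<omega> * indicator S \<omega>\<bar> \<le> C" for \<omega>
      using C[of \<omega>] by (auto simp: indicator_def)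
    moreover have "(\<lambda>\<omega>. ?g b \<omega> * indicator S \<omega>) \<in> borel_measurable M"
      using that EM X_fun_measurable[of "\<lambda>a. f a b" n] by measurable
    ultimately show ?thesis by (intro integrable_const_bound[of _ C]) auto
  qed
  have "expectation (\<lambda>\<omega>. indicator E \<omega> * f (X n \<omega>) (choice (Suc n) \<omega>))
      = expectation (\<lambda>\<omega>. \<Sum>b\<in>choices. ?g b \<omega> * indicator (?S b) \<omega>)"
  proof (rule Bochner_Integration.integral_cong[OF refl])
    fix \<omega> assume "\<omega> \<in> space M"
    then have "(\<Sum>b\<in>choices. ?g b \<omega> * indicator (?S b) \<omega>) =
        (\<Sum>b\<in>choices. if b = choice (Suc n) \<omega> then ?g b \<omega> else 0)"
      by (intro sum.cong) (auto simp: indicator_def)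
    then show "indicator E \<omega> * f (X n \<omega>) (choice (Suc n) \<omega>) = (\<Sum>b\<in>choices. ?g b \<omega> * indicator (?S b) \<omega>)"
      using choice_mem finite_choices by simp
  qed
  also have "\<dots> = (\<Sum>b\<in>choices. expectation (\<lambda>\<omega>. ?g b \<omega> * indicator (?S b) \<omega>))"
    by (intro Bochner_Integration.integral_sum gi choice_event)
  also have "\<dots> = (\<Sum>b\<in>choices. expectation (\<lambda>\<omega>. ?g b \<omega> * pmf (kernel (X n \<omega>)) b))"
  proof (intro sum.cong refl)
    fix b assume b: "b \<in> choices"
    have "expectation (\<lambda>\<omega>. ?g b \<omega> * indicator (?S b) \<omega>) =
        expectation (\<lambda>\<omega>. ?g b \<omega> * real_cond_exp M (Hist n) (indicator (?S b)) \<omega>)"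
      using choice_event[OF b] by (intro real_cond_exp_intg(2)[symmetric] gi gm) auto
    also have "\<dots> = expectation (\<lambda>\<omega>. ?g b \<omega> * pmf (kernel (X n \<omega>)) b)"
    proof (rule integral_cong_AE)
      show "(\<lambda>\<omega>. ?g b \<omega> * real_cond_exp M (Hist n) (indicator (?S b)) \<omega>) \<in> borel_measurable M"
        using measurable_from_subalg[OF subalgebra_Hist gm] by measurable
      show "(\<lambda>\<omega>. ?g b \<omega> * pmf (kernel (X n \<omega>)) b) \<in> borel_measurable M"
        using measurable_from_subalg[OF subalgebra_Hist gm] X_fun_measurable[of "\<lambda>a. pmf (kernel a) b" n]
        by measurable
      show "AE \<omega> in M. ?g b \<omega> * real_cond_exp M (Hist n) (indicator (?S b)) \<omega> = ?g b \<omega> * pmf (kernel (X n \<omega>)) b"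
        using choice_cond_prob[OF b, of n] by eventually_elim simp
    qed
    finally show "expectation (\<lambda>\<omega>. ?g b \<omega> * indicator (?S b) \<omega>) = expectation (\<lambda>\<omega>. ?g b \<omega> * pmf (kernel (X n \<omega>)) b)" .
  qed
  also have "\<dots> = expectation (\<lambda>\<omega>. \<Sum>b\<in>choices. ?g b \<omega> * pmf (kernel (X n \<omega>)) b)"
  proof (rule Bochner_Integration.integral_sum[symmetric])
    fix b
    show "integrable M (\<lambda>\<omega>. ?g b \<omega> * pmf (kernel (X n \<omega>)) b)"
    proof -
      have "integrable M (\<lambda>\<omega>. indicator E \<omega> *\<^sub>R (f (X n \<omega>) b * pmf (kernel (X n \<omega>)) b))"
        using X_fun_integrable[of "\<lambda>a. f a b * pmf (kernel a) b" n] EM by (intro integrable_mult_indicator)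
      then show ?thesis by (simp add: mult.assoc)
    qed
  qed
  also have "\<dots> = expectation (\<lambda>\<omega>. indicator E \<omega> * measure_pmf.expectation (kernel (X n \<omega>)) (f (X n \<omega>)))"
    by (subst integral_measure_pmf_real[OF finite_choices])
      (use set_kernel in \<open>auto simp: sum_distrib_left mult.assoc\<close>)
  finally show ?thesis .
qed

end


section \<open>Almost sure behaviour\<close>

context occupation_process
begin

lemma X_step_bound: "\<omega> \<in> space M \<Longrightarrow> i \<in> {1..m} \<Longrightarrow> \<bar>X (Suc n) \<omega> i - X n \<omega> i\<bar> \<le> 1 / (real n + 3)"
  unfolding X_Suc by (intro step_diff X_cube)

lemma expectation_X_Suc:
  fixes g :: "(nat \<Rightarrow> real) \<Rightarrow> real"
  shows "expectation (\<lambda>\<omega>. g (X (Suc n) \<omega>)) =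
    expectation (\<lambda>\<omega>. measure_pmf.expectation (kernel (X n \<omega>)) (\<lambda>b. g (step n (X n \<omega>) b)))"
proof -
  have "space M \<in> sets (Hist n)" using sets.top[of "Hist n"] by simp
  from one_step[OF this, of "\<lambda>a b. g (step n a b)"] show ?thesis
    by (simp add: X_Suc cong: Bochner_Integration.integral_cong)
qed

lemma total_defect_nonneg: "\<omega> \<in> space M \<Longrightarrow> 0 \<le> total_defect (X n \<omega>)"
  unfolding total_defect_def by (intro sum_nonneg defect_bounds X_cube)

text \<open>The expected energy increments telescope and the energy is bounded by \<open>m\<close>,
  so the expected defects, weighted by \<open>1 / (n + 3)\<close>, have bounded partial
  sums.\<close>

lemma summable_expected_defect:
  "summable (\<lambda>n. expectation (\<lambda>\<omega>. total_defect (X n \<omega>) / (real n + 3)))"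
proof -
  obtain c where c: "c > 0" "\<And>n a. a \<in> cube \<Longrightarrow>
      energy a + c * (total_defect a / (real n + 3)) - m * (1 / (real n + 3))^2
      \<le> measure_pmf.expectation (kernel a) (\<lambda>b. energy (step n a b))"
    using expected_energy_step by blast
  let ?e = "\<lambda>n. expectation (\<lambda>\<omega>. energy (X n \<omega>))"
  let ?d = "\<lambda>n. expectation (\<lambda>\<omega>. total_defect (X n \<omega>) / (real n + 3))"
  let ?g = "\<lambda>n. m * (1 / (real n + 3))^2"
  have step: "c * ?d n \<le> ?e (Suc n) - ?e n + ?g n" for n
  proof -
    have i1: "integrable M (\<lambda>\<omega>. energy (X n \<omega>))"
      and i2: "integrable M (\<lambda>\<omega>. total_defect (X n \<omega>))"
      by (rule X_fun_integrable)+
    have "?e n + c * ?d n - ?g n =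
        expectation (\<lambda>\<omega>. energy (X n \<omega>) + c * (total_defect (X n \<omega>) / (real n + 3)) - ?g n)"
      using i1 i2 by (simp add: prob_space)
    also have "\<dots> \<le> expectation (\<lambda>\<omega>. measure_pmf.expectation (kernel (X n \<omega>)) (\<lambda>b. energy (step n (X n \<omega>) b)))"
    proof (rule integral_mono)
      show "integrable M (\<lambda>\<omega>. energy (X n \<omega>) + c * (total_defect (X n \<omega>) / (real n + 3)) - ?g n)"
        using X_fun_integrable[of "\<lambda>a. energy a + c * (total_defect a / (real n + 3)) - ?g n" n] .
      show "integrable M (\<lambda>\<omega>. measure_pmf.expectation (kernel (X n \<omega>)) (\<lambda>b. energy (step n (X n \<omega>) b)))"
        using X_fun_integrable[of "\<lambda>a. measure_pmf.expectation (kernel a) (\<lambda>b. energy (step n a b))" n] .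
    qed (use c(2) X_cube in auto)
    also have "\<dots> = ?e (Suc n)" by (rule expectation_X_Suc[symmetric])
    finally show ?thesis by simp
  qed
  have e_bound: "\<bar>?e n\<bar> \<le> m" for n
  proof -
    have "\<bar>?e n\<bar> \<le> expectation (\<lambda>\<omega>. \<bar>energy (X n \<omega>)\<bar>)" by (rule integral_abs_bound)
    also have "\<dots> \<le> expectation (\<lambda>\<omega>. real m)"
      using X_fun_integrable[of "\<lambda>a. \<bar>energy a\<bar>" n] energy_bound X_cube by (intro integral_mono) auto
    finally show ?thesis by (simp add: prob_space)
  qed
  have sq: "summable ?g"
    using summable_ignore_initial_segment[OF inverse_power_summable[of 2, where 'a = real], of 3]
    by (intro summable_mult) (simp add: field_simps)
  have "(\<Sum>n<N. ?d n) \<le> (2 * m + suminf ?g) / c" for N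
  proof -
    have "c * (\<Sum>n<N. ?d n) = (\<Sum>n<N. c * ?d n)" by (simp add: sum_distrib_left)
    also have "\<dots> \<le> (\<Sum>n<N. ?e (Suc n) - ?e n + ?g n)" by (intro sum_mono step)
    also have "\<dots> = ?e N - ?e 0 + (\<Sum>n<N. ?g n)" by (simp add: sum.distrib sum_lessThan_telescope[of ?e])
    also have "\<dots> \<le> 2 * m + suminf ?g"
      using e_bound[of N] e_bound[of 0] sum_le_suminf[OF sq, of "{..<N}"] by (auto simp: abs_le_iff)
    finally show ?thesis using c(1) by (simp add: field_simps)
  qed
  moreover have "0 \<le> ?d n" for n
    using total_defect_nonneg by (intro integral_nonneg_AE AE_I2 divide_nonneg_nonneg) auto
  ultimately show ?thesis by (intro summableI_nonneg_bounded) auto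
qed

text \<open>A finite expected series is almost surely finite; the step size bound supplies the slow
  variation required by \<open>tendsto_zero_if_harmonic_summable\<close>.\<close>

lemma AE_total_defect_tendsto: "AE \<omega> in M. (\<lambda>n. total_defect (X n \<omega>)) \<longlonglongrightarrow> 0"
proof -
  let ?f = "\<lambda>n \<omega>. total_defect (X n \<omega>) / (real n + 3)"
  have fm: "?f n \<in> borel_measurable M" for n
    by (rule X_fun_measurable)
  have nn: "0 \<le> ?f n \<omega>" if "\<omega> \<in> space M" for n \<omega>
    using total_defect_nonneg[OF that] by simp
  have "(\<integral>\<^sup>+\<omega>. (\<Sum>n. ennreal (?f n \<omega>)) \<partial>M) = (\<Sum>n. \<integral>\<^sup>+\<omega>. ennreal (?f n \<omega>) \<partial>M)"
    using fm by (intro nn_integral_suminf) auto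
  also have "\<dots> = (\<Sum>n. ennreal (expectation (?f n)))"
    using X_fun_integrable[of "\<lambda>a. total_defect a / (real n + 3)" n for n] nn
    by (subst nn_integral_eq_integral) auto
  also have "\<dots> = ennreal (\<Sum>n. expectation (?f n))"
    using nn by (intro suminf_ennreal2 summable_expected_defect integral_nonneg_AE AE_I2) auto
  finally have "(\<integral>\<^sup>+\<omega>. (\<Sum>n. ennreal (?f n \<omega>)) \<partial>M) \<noteq> \<infinity>" by simp
  then have "AE \<omega> in M. (\<Sum>n. ennreal (?f n \<omega>)) \<noteq> \<infinity>"
    using fm by (intro nn_integral_PInf_AE) auto
  then show ?thesis using AE_space
  proof eventually_elim
    case (elim \<omega>)
    then have "summable (\<lambda>n. ?f n \<omega>)" using nn by (intro summable_suminf_not_top) auto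
    then show ?case
    proof (rule tendsto_zero_if_harmonic_summable[rotated 2])
      show "0 \<le> total_defect (X n \<omega>)" for n using total_defect_nonneg elim by simp
      fix n
      have "\<bar>total_defect (X (Suc n) \<omega>) - total_defect (X n \<omega>)\<bar> \<le>
          (\<Sum>i\<in>{1..m}. \<bar>defect m (X (Suc n) \<omega>) i - defect m (X n \<omega>) i\<bar>)"
        unfolding total_defect_def sum_subtractf[symmetric] by (rule sum_abs)
      also have "\<dots> \<le> (\<Sum>i\<in>{1..m}. 5 * (1 / (real n + 3)))"
        using elim by (intro sum_mono defect_lipschitz X_cube X_step_bound)
      finally show "\<bar>total_defect (X (Suc n) \<omega>) - total_defect (X n \<omega>)\<bar> \<le> (real m * 5) / (real n + 3)" by simp
    qed
  qed
qed

text \<open>The probability that a chain at \<open>a\<close> at time \<open>n\<close> is near at the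
  \<open>k + 1\<close> times from \<open>n\<close> to \<open>n + k\<close>. Time is an argument
  because \<open>step\<close> depends on it.\<close>

primrec staying :: "real \<Rightarrow> nat \<Rightarrow> nat \<Rightarrow> (nat \<Rightarrow> real) \<Rightarrow> real" where
  "staying r 0 n a = of_bool (near r a)"
| "staying r (Suc k) n a =
     of_bool (near r a) * measure_pmf.expectation (kernel a) (\<lambda>b. staying r k (Suc n) (step n a b))"

lemma staying_nonneg: "0 \<le> staying r k n a"
  by (induction k arbitrary: n a) (auto intro: integral_nonneg_AE)

lemma staying_le_1: "staying r k n a \<le> 1"
proof (induction k arbitrary: n a)
  case (Suc k)
  have "measure_pmf.expectation (kernel a) (\<lambda>b. staying r k (Suc n) (step n a b))
      \<le> measure_pmf.expectation (kernel a) (\<lambda>b. 1)"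
    by (intro expectation_finite_mono finite_kernel Suc)
  then show ?case by simp
qed simp

lemma staying_decreasing: "staying r (Suc k) n a \<le> staying r k n a"
proof (induction k arbitrary: n a)
  case 0
  then show ?case using staying_le_1[of r "Suc 0" n a] by (cases "near r a") auto
next
  case (Suc k)
  then show ?case unfolding staying.simps(2)[of r "Suc k"] staying.simps(2)[of r k]
    by (intro mult_left_mono expectation_finite_mono finite_kernel) auto
qed

text \<open>The decreasing limits in \<open>k\<close> inherit the recursion, since limits pass
  through finite sums, and vanish off the neighbourhood; so they form a function as in
  \<open>subsolution_zero\<close>.\<close>

lemma staying_tendsto_0:
  assumes ex: "expanding r c"
  shows "(\<lambda>k. staying r k n a) \<longlonglongrightarrow> 0"
proof -
  define h where "h = (\<lambda>n a. lim (\<lambda>k. staying r k n a))"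
  have conv: "(\<lambda>k. staying r k n a) \<longlonglongrightarrow> h n a" for n a
  proof -
    have "decseq (\<lambda>k. staying r k n a)" by (intro decseq_SucI staying_decreasing)
    then obtain L where "(\<lambda>k. staying r k n a) \<longlonglongrightarrow> L"
      by (rule decseq_convergent[where B = 0]) (simp_all add: staying_nonneg)
    then have "convergent (\<lambda>k. staying r k n a)" by (rule convergentI)
    then show ?thesis by (simp add: h_def convergent_LIMSEQ_iff)
  qed
  have "h n a = 0"
  proof (rule subsolution_zero[where h = h, OF ex])
    show "0 \<le> h n a" for n a using staying_nonneg by (intro tendsto_lowerbound[OF conv]) auto
    show "h n a \<le> 1" for n a using staying_le_1 by (intro tendsto_upperbound[OF conv]) auto
    show "h n a = 0" if "\<not> near r a" for n a
    proof -
      have "staying r k n a = 0" for k using that by (cases k) auto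
      then show ?thesis by (simp add: h_def)
    qed
    show "h n a \<le> measure_pmf.expectation (kernel a) (\<lambda>b. h (Suc n) (step n a b))" if a: "near r a" for n a
    proof -
      let ?S = "set_pmf (kernel a)"
      have sum: "measure_pmf.expectation (kernel a) g = (\<Sum>b\<in>?S. g b * pmf (kernel a) b)" for g :: "_ \<Rightarrow> real"
        by (intro integral_measure_pmf_real finite_kernel)
      have "(\<lambda>k. \<Sum>b\<in>?S. staying r k (Suc n) (step n a b) * pmf (kernel a) b)
          \<longlonglongrightarrow> (\<Sum>b\<in>?S. h (Suc n) (step n a b) * pmf (kernel a) b)"
        by (intro tendsto_sum tendsto_mult conv tendsto_const)
      then have "(\<lambda>k. staying r (Suc k) n a) \<longlonglongrightarrow> measure_pmf.expectation (kernel a) (\<lambda>b. h (Suc n) (step n a b))"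
        using a by (simp add: sum)
      moreover have "(\<lambda>k. staying r (Suc k) n a) \<longlonglongrightarrow> h n a" by (rule LIMSEQ_Suc[OF conv])
      ultimately show ?thesis using LIMSEQ_unique by fastforce
    qed
  qed
  with conv[of n a] show ?thesis by simp
qed

lemma near_event: "k \<le> n \<Longrightarrow> {\<omega> \<in> space M. near r (X k \<omega>)} \<in> sets (Hist n)"
  using measurable_sets[OF X_measurable_Hist, of k n "Collect (near r)"]
  by (simp add: vimage_def Int_def conj_commute)

lemma Hist_subset_events: "E \<in> sets (Hist n) \<Longrightarrow> E \<in> sets M"
  using subalgebra_Hist[of n] by (auto simp: subalgebra_def)

lemma sets_Hist_mono: "n \<le> n' \<Longrightarrow> sets (Hist n) \<subseteq> sets (Hist n')"
  unfolding sets_Hist by (intro sigma_sets_mono') fastforce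

text \<open>\<open>E\<close> is an arbitrary history event because the induction absorbs the
  condition at time \<open>n\<close> into it before passing to time \<open>n + 1\<close>.\<close>

lemma prob_stay_le:
  "E \<in> sets (Hist n) \<Longrightarrow> prob (E \<inter> {\<omega> \<in> space M. \<forall>j\<le>k. near r (X (n + j) \<omega>)})
     \<le> expectation (\<lambda>\<omega>. indicator E \<omega> * staying r k n (X n \<omega>))"
proof (induction k arbitrary: n E)
  case (0 n E)
  have "prob (E \<inter> {\<omega> \<in> space M. near r (X n \<omega>)}) = expectation (indicator (E \<inter> {\<omega> \<in> space M. near r (X n \<omega>)}))"
    using Hist_subset_events[OF sets.Int[OF 0 near_event[of n n]]] by simp
  also have "\<dots> = expectation (\<lambda>\<omega>. indicator E \<omega> * staying r 0 n (X n \<omega>))"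
    by (intro Bochner_Integration.integral_cong refl) (auto simp: indicator_def)
  finally show ?case by simp
next
  case (Suc k n E)
  let ?N = "{\<omega> \<in> space M. near r (X n \<omega>)}"
  have E': "E \<inter> ?N \<in> sets (Hist n)" using Suc.prems near_event[of n n] by (rule sets.Int) simp
  have split: "E \<inter> {\<omega> \<in> space M. \<forall>j\<le>Suc k. near r (X (n + j) \<omega>)} =
      (E \<inter> ?N) \<inter> {\<omega> \<in> space M. \<forall>j\<le>k. near r (X (Suc n + j) \<omega>)}"
    by (auto simp: less_Suc_eq_le[symmetric] All_less_Suc2)
  have "prob ((E \<inter> ?N) \<inter> {\<omega> \<in> space M. \<forall>j\<le>k. near r (X (Suc n + j) \<omega>)})
      \<le> expectation (\<lambda>\<omega>. indicator (E \<inter> ?N) \<omega> * staying r k (Suc n) (X (Suc n) \<omega>))"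
    by (rule Suc.IH[OF subsetD[OF sets_Hist_mono[OF le_SucI[OF order_refl]] E']])
  also have "\<dots> = expectation (\<lambda>\<omega>. indicator (E \<inter> ?N) \<omega> *
      measure_pmf.expectation (kernel (X n \<omega>)) (\<lambda>b. staying r k (Suc n) (step n (X n \<omega>) b)))"
    unfolding X_Suc by (rule one_step[OF E', of "\<lambda>a b. staying r k (Suc n) (step n a b)"])
  also have "\<dots> = expectation (\<lambda>\<omega>. indicator E \<omega> * staying r (Suc k) n (X n \<omega>))"
    by (intro Bochner_Integration.integral_cong refl) (auto simp: indicator_def)
  finally show ?case unfolding split .
qed

lemma AE_not_staying:
  assumes ex: "expanding r c"
  shows "AE \<omega> in M. \<not> (\<exists>n. \<forall>k. near r (X (n + k) \<omega>))"
proof -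
  have "AE \<omega> in M. \<not> (\<forall>k. near r (X (n + k) \<omega>))" for n
  proof -
    let ?S = "{\<omega> \<in> space M. \<forall>k. near r (X (n + k) \<omega>)}"
    have near_M: "{\<omega> \<in> space M. near r (X j \<omega>)} \<in> sets M" for j
      using Hist_subset_events[OF near_event[of j j]] by simp
    have S: "?S \<in> sets M"
      by (intro sets.sets_Collect_countable_All near_M)
    \<comment> \<open>A sum over the finitely many possible states at time \<open>n\<close> replaces
      the expectation, so convergence for each single state suffices.\<close>
    have "prob ?S \<le> (\<Sum>a\<in>range (X n). staying r k n a)" for k
    proof -
      have fin: "{\<omega> \<in> space M. \<forall>j\<le>k. near r (X (n + j) \<omega>)} \<in> sets M"
        using sets.sets_Collect_finite_All[of "{..k}" M "\<lambda>j \<omega>. near r (X (n + j) \<omega>)"] near_M by simp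
      have "prob ?S \<le> prob (space M \<inter> {\<omega> \<in> space M. \<forall>j\<le>k. near r (X (n + j) \<omega>)})"
        by (rule finite_measure_mono[OF _ sets.Int[OF sets.top fin]]) blast
      also have "\<dots> \<le> expectation (\<lambda>\<omega>. indicator (space M) \<omega> * staying r k n (X n \<omega>))"
        using sets.top[of "Hist n"] by (intro prob_stay_le) (simp only: space_Hist)
      also have "\<dots> \<le> expectation (\<lambda>\<omega>. \<Sum>a\<in>range (X n). staying r k n a)"
      proof (rule integral_mono)
        have "integrable M (\<lambda>\<omega>. indicator (space M) \<omega> *\<^sub>R staying r k n (X n \<omega>))"
          by (intro integrable_mult_indicator X_fun_integrable) simp
        then show "integrable M (\<lambda>\<omega>. indicator (space M) \<omega> * staying r k n (X n \<omega>))" by simp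
        show "indicator (space M) \<omega> * staying r k n (X n \<omega>) \<le> (\<Sum>a\<in>range (X n). staying r k n a)"
          if "\<omega> \<in> space M" for \<omega>
          using that member_le_sum[of "X n \<omega>" "range (X n)" "\<lambda>a. staying r k n a"] X_range[of n] staying_nonneg
          by simp
      qed simp
      finally show ?thesis by (simp add: prob_space)
    qed
    moreover have "(\<lambda>k. \<Sum>a\<in>range (X n). staying r k n a) \<longlonglongrightarrow> (\<Sum>a\<in>range (X n). 0)"
      by (intro tendsto_sum staying_tendsto_0[OF ex])
    ultimately have "prob ?S \<le> 0" by (intro tendsto_lowerbound[where F = sequentially]) auto
    then have "prob ?S = 0" using measure_nonneg[of M ?S] by linarith
    then have "AE \<omega> in M. \<omega> \<notin> ?S" using S by (intro AE_not_in) (auto simp: emeasure_eq_measure null_sets_def)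
    then show ?thesis using AE_space by eventually_elim auto
  qed
  then show ?thesis by (simp add: AE_all_countable)
qed

lemma AE_product_tendsto:
  assumes "\<not> 4 dvd m"
  shows "AE \<omega> in M. (\<lambda>n. \<Prod>i\<in>{1..m}. X n \<omega> i * (1 - X n \<omega> i)) \<longlonglongrightarrow> 0"
proof -
  obtain r c where ex: "expanding r c" using ex_expanding by blast
  then have r: "0 < r" "r \<le> 1/4" by (auto simp: expanding_def)
  show ?thesis
    using AE_total_defect_tendsto AE_not_staying[OF ex] AE_space
  proof eventually_elim
    case (elim \<omega>)
    show ?case
      using X_cube[OF elim(3)] X_step_bound[OF elim(3)] elim(1,2)
      by (intro trapped_or_unmixed[OF assms r]) auto
  qed
qed

end


section \<open>Limit sets\<close>

text \<open>Tychonoff, applied once for each of the two arguments.\<close>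

lemma compact_cube: "compact {x :: nat \<Rightarrow> nat \<Rightarrow> real. \<forall>i v. 0 \<le> x i v \<and> x i v \<le> 1}"
proof -
  have PiE: "compact (PiE UNIV S)" if "\<And>i. compact (S i)" for S :: "nat \<Rightarrow> 'b::topological_space set"
    using that compactin_PiE[of "\<lambda>_. euclidean" UNIV S]
    unfolding euclidean_product_topology compactin_euclidean_iff by blast
  have "compact (PiE (UNIV :: nat set) (\<lambda>_. PiE (UNIV :: nat set) (\<lambda>_. {0..1::real})))"
    by (intro PiE) simp
  also have "PiE UNIV (\<lambda>_. PiE UNIV (\<lambda>_. {0..1})) = {x :: nat \<Rightarrow> nat \<Rightarrow> real. \<forall>i v. 0 \<le> x i v \<and> x i v \<le> 1}"
    by (auto simp: PiE_UNIV_domain Pi_iff)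
  finally show ?thesis .
qed

lemma limit_set_subset_closed:
  assumes "closed S" "eventually (\<lambda>n. x n \<in> S) sequentially"
  shows "limit_set x \<subseteq> S"
proof -
  obtain N where "\<And>n. n \<ge> N \<Longrightarrow> x n \<in> S" using assms(2) by (auto simp: eventually_sequentially)
  then have "closure (\<Union>k\<in>{N..}. {x k}) \<subseteq> S" using assms(1) by (intro closure_minimal) auto
  then show ?thesis unfolding limit_set_def by blast
qed

text \<open>A common point of the nested closed tails intersected with \<open>S\<close> exists by
  the finite intersection property: a late visit to \<open>S\<close> lies in any finite number of
  them.\<close>

lemma limit_set_meets:
  fixes x :: "nat \<Rightarrow> 'b::topological_space"
  assumes K: "compact K" "\<And>n. x n \<in> K" and S: "closed S" and fr: "frequently (\<lambda>n. x n \<in> S) sequentially"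
  shows "limit_set x \<inter> S \<noteq> {}"
proof -
  let ?A = "\<lambda>N. closure (\<Union>k\<in>{N..}. {x k}) \<inter> S"
  have "K \<inter> (\<Inter>N. ?A N) \<noteq> {}"
  proof (rule compact_imp_fip_image[OF K(1)])
    show "closed (?A N)" for N using S by auto
    fix I' :: "nat set" assume I: "finite I'"
    obtain k where k: "k \<ge> Max (insert 0 I')" "x k \<in> S"
      using fr unfolding frequently_sequentially by blast
    have "x k \<in> ?A N" if "N \<in> I'" for N
    proof -
      have "N \<le> k" using k(1) I that by (meson Max_ge finite_insert insertI2 le_trans)
      then have "x k \<in> closure (\<Union>k\<in>{N..}. {x k})" by (intro subsetD[OF closure_subset]) auto
      with k(2) show ?thesis by simp
    qed
    then show "K \<inter> (\<Inter>N\<in>I'. ?A N) \<noteq> {}" using K(2)[of k] by blast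
  qed
  then show ?thesis unfolding limit_set_def by auto
qed

text \<open>If the values did not tend to 0, the path would visit some closed set
  \<open>{p. e \<le> \<bar>g p\<bar>}\<close> infinitely often and accumulate there. This
  implication serves the measurability of the limit set event, the converse its probability.\<close>

lemma limit_set_subset_zeros_iff:
  fixes g :: "'b::topological_space \<Rightarrow> real"
  assumes K: "compact K" "\<And>n. x n \<in> K" and C: "closed C" "\<And>n. x n \<in> C" and g: "continuous_on UNIV g"
  shows "limit_set x \<subseteq> {p \<in> C. g p = 0} \<longleftrightarrow> (\<lambda>n. g (x n)) \<longlonglongrightarrow> 0"
proof
  assume sub: "limit_set x \<subseteq> {p \<in> C. g p = 0}"
  show "(\<lambda>n. g (x n)) \<longlonglongrightarrow> 0"
  proof (rule ccontr)
    assume "\<not> (\<lambda>n. g (x n)) \<longlonglongrightarrow> 0"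
    then obtain e where e: "e > 0" "frequently (\<lambda>n. x n \<in> {p. e \<le> \<bar>g p\<bar>}) sequentially"
      unfolding tendsto_iff by (auto simp: not_eventually not_less)
    have "closed {p. e \<le> \<bar>g p\<bar>}"
      using g by (intro closed_Collect_le continuous_intros) auto
    from limit_set_meets[OF K this e(2)] sub e(1) show False by auto
  qed
next
  assume lim: "(\<lambda>n. g (x n)) \<longlonglongrightarrow> 0"
  have small: "\<bar>g p\<bar> \<le> e" if p: "p \<in> limit_set x" and e: "e > 0" for p e
  proof -
    have "closed {p. \<bar>g p\<bar> \<le> e}" using g by (intro closed_Collect_le continuous_intros) auto
    moreover have "eventually (\<lambda>n. x n \<in> {p. \<bar>g p\<bar> \<le> e}) sequentially"
      using tendstoD[OF lim e] by eventually_elim simp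
    ultimately show ?thesis using limit_set_subset_closed p by blast
  qed
  have "g p = 0" if "p \<in> limit_set x" for p
  proof -
    have "\<bar>g p\<bar> \<le> 0" by (rule field_le_epsilon) (simp add: small[OF that])
    then show ?thesis by simp
  qed
  moreover have "limit_set x \<subseteq> C" by (rule limit_set_subset_closed[OF C(1)]) (simp add: C(2))
  ultimately show "limit_set x \<subseteq> {p \<in> C. g p = 0}" by auto
qed

section \<open>Topology of the state space and measurability of the limit set event\<close>

lemma continuous_coordinate: "continuous_on S (\<lambda>x :: nat \<Rightarrow> nat \<Rightarrow> real. x i v)"
  by (rule continuous_on_product_then_coordinatewise[of S "\<lambda>x. x i" v],
      rule continuous_on_product_then_coordinatewise[of S "\<lambda>x. x" i], rule continuous_on_id)

lemma closed_state_space: "closed (state_space m)"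
proof -
  have "state_space m = (\<Inter>i\<in>{1..m}. (\<Inter>v\<in>V m i. {x. 0 \<le> x i v}) \<inter> {x. x i i + x i (cyc_succ m i) = 1}) \<inter>
     (\<Inter>i. \<Inter>v. {x. \<not> (i \<in> {1..m} \<and> v \<in> V m i) \<longrightarrow> x i v = 0})"
    unfolding state_space_def by blast
  also have "closed \<dots>"
    by (intro closed_INT closed_Int ballI closed_Collect_le closed_Collect_eq closed_Collect_imp
        open_Collect_const continuous_intros continuous_coordinate)
  finally show ?thesis .
qed

lemma state_space_unit_cube: "state_space m \<subseteq> {x. \<forall>i v. 0 \<le> x i v \<and> x i v \<le> 1}"
proof (intro subsetI CollectI allI)
  fix x i v assume x: "x \<in> state_space m"
  consider "\<not> (i \<in> {1..m} \<and> v \<in> V m i)" | "i \<in> {1..m}" "v = i" | "i \<in> {1..m}" "v = cyc_succ m i"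
    by (auto simp: V_def)
  then show "0 \<le> x i v \<and> x i v \<le> 1"
  proof cases
    case 1
    then have "x i v = 0" using x unfolding state_space_def by blast
    then show ?thesis by simp
  next
    case 2
    then show ?thesis using state_space_bounds[OF x 2(1)] by (simp add: diag_def)
  next
    case 3
    then show ?thesis using state_space_bounds[OF x 3(1)] state_space_succ[OF x 3(1)] by simp
  qed
qed

lemma continuous_diag: "continuous_on S (\<lambda>x. diag x i)"
  unfolding diag_def by (rule continuous_coordinate)

text \<open>Countable quantifiers only, so that convergence defines a measurable event.\<close>

lemma LIMSEQ_zero_iff:
  fixes f :: "nat \<Rightarrow> real"
  shows "f \<longlonglongrightarrow> 0 \<longleftrightarrow> (\<forall>k::nat. \<exists>N. \<forall>n\<ge>N. \<bar>f n\<bar> < inverse (real (Suc k)))"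
proof
  assume "f \<longlonglongrightarrow> 0"
  then have "\<exists>N. \<forall>n\<ge>N. norm (f n - 0) < inverse (real (Suc k))" for k
    by (rule LIMSEQ_D) simp
  then show "\<forall>k::nat. \<exists>N. \<forall>n\<ge>N. \<bar>f n\<bar> < inverse (real (Suc k))" by simp
next
  assume *: "\<forall>k::nat. \<exists>N. \<forall>n\<ge>N. \<bar>f n\<bar> < inverse (real (Suc k))"
  show "f \<longlonglongrightarrow> 0"
  proof (rule LIMSEQ_I)
    fix e :: real assume "0 < e"
    then obtain k where k: "inverse (real (Suc k)) < e" using reals_Archimedean by blast
    from * obtain N where "\<forall>n\<ge>N. \<bar>f n\<bar> < inverse (real (Suc k))" by blast
    then have "\<forall>n\<ge>N. norm (f n - 0) < e" using less_trans[OF _ k] by simp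
    then show "\<exists>N. \<forall>n\<ge>N. norm (f n - 0) < e" ..
  qed
qed

context occupation_process
begin

lemma prob_limit_set_eq_1:
  fixes g :: "(nat \<Rightarrow> real) \<Rightarrow> real"
  assumes g: "continuous_on UNIV (\<lambda>x. g (diag x))" and lim: "AE \<omega> in M. (\<lambda>n. g (X n \<omega>)) \<longlonglongrightarrow> 0"
    and S: "S = {x \<in> state_space m. g (diag x) = 0}"
  shows "\<P>(\<omega> in M. limit_set (\<lambda>n. occupation m W n \<omega>) \<subseteq> S) = 1"
proof -
  have iff: "limit_set (\<lambda>n. occupation m W n \<omega>) \<subseteq> S \<longleftrightarrow> (\<lambda>n. g (X n \<omega>)) \<longlonglongrightarrow> 0"
    if "\<omega> \<in> space M" for \<omega>
    unfolding S X_def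
    using occupation_state_space[OF that] state_space_unit_cube
    by (intro limit_set_subset_zeros_iff[OF compact_cube _ closed_state_space _ g]) blast+
  have [measurable]: "(\<lambda>\<omega>. g (X n \<omega>)) \<in> borel_measurable M" for n by (rule X_fun_measurable)
  have "{\<omega> \<in> space M. limit_set (\<lambda>n. occupation m W n \<omega>) \<subseteq> S} = {\<omega> \<in> space M. (\<lambda>n. g (X n \<omega>)) \<longlonglongrightarrow> 0}"
    using iff by blast
  moreover have "{\<omega> \<in> space M. (\<lambda>n. g (X n \<omega>)) \<longlonglongrightarrow> 0} \<in> sets M"
    unfolding LIMSEQ_zero_iff by measurable
  ultimately show ?thesis using lim by (simp add: prob_Collect_eq_1)
qed

end


theorem theorem7:
  fixes M :: "'a measure" and m :: nat and \<alpha> \<eta> :: real and W :: "nat \<Rightarrow> nat \<Rightarrow> 'a \<Rightarrow> nat"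
  assumes "m \<ge> 3" and "\<alpha> > 0" and "\<eta> > 1"
    and "prob_space M" and "interacting_walks M m \<eta> \<alpha> W"
  shows "(C1 m \<union> C2 m \<union> C3 m \<union> C4 m = Fix m \<eta> \<alpha> \<and>
          \<P>(\<omega> in M. limit_set (\<lambda>n. occupation m W n \<omega>) \<subseteq> C1 m \<union> C2 m \<union> C3 m \<union> C4 m) = 1) \<and>
         (\<not> 4 dvd m \<longrightarrow>
          C3 m \<union> C4 m \<subseteq> Fix m \<eta> \<alpha> \<and>
          \<P>(\<omega> in M. limit_set (\<lambda>n. occupation m W n \<omega>) \<subseteq> C3 m \<union> C4 m) = 1)"
proof -
  interpret occupation_process m \<eta> \<alpha> M W
    by (intro occupation_process.intro cycle_dynamics.intro occupation_process_axioms.intro assms)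
  have Fix: "C1 m \<union> C2 m \<union> C3 m \<union> C4 m = Fix m \<eta> \<alpha>"
    unfolding C1234_eq[OF m] Fix_eq ..
  have total0: "total_defect (diag x) = 0 \<longleftrightarrow> (\<forall>i\<in>{1..m}. defect m (diag x) i = 0)"
    if "x \<in> state_space m" for x
    unfolding total_defect_def using defect_bounds[OF diag_in_cube[OF that]]
    by (intro sum_nonneg_eq_0_iff) auto
  have prod_nonneg: "0 \<le> (\<Prod>i\<in>{1..m}. diag x i * (1 - diag x i))" if "x \<in> state_space m" for x
    using state_space_bounds[OF that] by (intro prod_nonneg) auto
  have cont: "continuous_on UNIV (\<lambda>x. total_defect (diag x))"
    unfolding total_defect_def defect_def by (intro continuous_intros continuous_diag)
  have 1: "\<P>(\<omega> in M. limit_set (\<lambda>n. occupation m W n \<omega>) \<subseteq> C1 m \<union> C2 m \<union> C3 m \<union> C4 m) = 1"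
    using total0 by (intro prob_limit_set_eq_1[OF cont AE_total_defect_tendsto]) (auto simp: C1234_eq[OF m])
  have 2: "\<P>(\<omega> in M. limit_set (\<lambda>n. occupation m W n \<omega>) \<subseteq> C3 m \<union> C4 m) = 1" if "\<not> 4 dvd m"
  \<comment> \<open>Both summands are nonnegative on the state space, so the zero set of their sum
    is the intersection described by \<open>C34_eq\<close>.\<close>
  proof (rule prob_limit_set_eq_1[where g = "\<lambda>a. total_defect a + (\<Prod>i\<in>{1..m}. a i * (1 - a i))"])
    show "continuous_on UNIV (\<lambda>x. total_defect (diag x) + (\<Prod>i\<in>{1..m}. diag x i * (1 - diag x i)))"
      by (intro continuous_intros cont continuous_diag)
    show "AE \<omega> in M. (\<lambda>n. total_defect (X n \<omega>) + (\<Prod>i\<in>{1..m}. X n \<omega> i * (1 - X n \<omega> i))) \<longlonglongrightarrow> 0"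
      using AE_total_defect_tendsto AE_product_tendsto[OF that]
    proof eventually_elim
      case (elim \<omega>)
      from tendsto_add[OF this] show ?case by simp
    qed
    have "total_defect (diag x) + (\<Prod>i\<in>{1..m}. diag x i * (1 - diag x i)) = 0 \<longleftrightarrow>
        (\<forall>i\<in>{1..m}. defect m (diag x) i = 0) \<and> (\<Prod>i\<in>{1..m}. diag x i * (1 - diag x i)) = 0"
      if "x \<in> state_space m" for x
    proof -
      have "0 \<le> total_defect (diag x)"
        unfolding total_defect_def using defect_bounds[OF diag_in_cube[OF that]] by (intro sum_nonneg)
      then show ?thesis
        unfolding total0[OF that, symmetric] by (intro add_nonneg_eq_0_iff prod_nonneg that)
    qed
    then show "C3 m \<union> C4 m = {x \<in> state_space m. total_defect (diag x) + (\<Prod>i\<in>{1..m}. diag x i * (1 - diag x i)) = 0}"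
      unfolding C34_eq[OF m] by blast
  qed
  show ?thesis using Fix 1 2 by blast
qed

end
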